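(* Let $\mathcal{G}=(\mathcal{V},\mathcal{E})$ be the icosahedral graph (the graph of vertices and edges of the regular icosahedron, with $12$ vertices and $30$ edges), and let $$p_{\mathcal{G},3}(x_0,x,y)=x_0^3-3x_0\left(\|x\|^2+\|y\|^2\right)+9\sum_{\{i,j\}\in\mathcal{E}}x_ix_jy_{ij},$$ a cubic form in the $43$ variables $x_0\in\mathbb{R}$, $x=(x_i)_{i\in\mathcal{V}}$, $y=(y_{ij})_{\{i,j\}\in\mathcal{E}}$ (which is hyperbolic with respect to $e_0$). Then no power of $p_{\mathcal{G},3}$ has a definite determinantal representation; that is, there is no positive integer $\ell$ such that $p_{\mathcal{G},3}^\ell$ has a definite determinantal representation.
   Context: $\|\cdot\|$ is the Euclidean norm and $e_0$ is the standard basis vector with $x_0=1$, $x=0$, $y=0$. A homogeneous polynomial $r$ on $\mathbb{R}^n$ is hyperbolic with respect to $e\in\mathbb{R}^n$ if $r(e)>0$ and for every $v\in\mathbb{R}^n$ the polynomial $t\mapsto r(v+te)$ has only real zeros. A polynomial $r$ of degree $D$ in $n$ variables, hyperbolic with respect to $e$, has a definite determinantal representation if there are $D\times D$ real symmetric matrices $A_1,\ldots,A_n$ such that $r(v)=\det\left(\sum_{i=1}^nA_iv_i\right)$ and the matrix $\sum_{i=1}^n A_i e^{(i)}$ is positive definite, where $e=(e^{(1)},\ldots,e^{(n)})$. Here this is applied with $e=e_0$ and $r=p_{\mathcal{G},3}^\ell$, $D=3\ell$. *)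

theory Defs
  imports
    "HOL-Analysis.Analysis"
    "Jordan_Normal_Form.Determinant"
begin

text \<open>
  Real polynomials in \<open>n\<close> variables are identified with polynomial functions on a Euclidean space
  of dimension \<open>n\<close>; the variables are the coordinates with respect to \<^const>\<open>Basis\<close>.
\<close>

definition homogeneous_form :: "nat \<Rightarrow> ('a::euclidean_space \<Rightarrow> real) \<Rightarrow> bool" where
  "homogeneous_form d r \<longleftrightarrow>
     real_polynomial_function r \<and> (\<forall>c v. r (c *\<^sub>R v) = c ^ d * r v)"

text \<open>The polynomial \<open>q\<close> below is the univariate polynomial \<open>t \<mapsto> r (v + t e)\<close>; it is unique because
  the reals are infinite. Its zeros are taken in the complex numbers.\<close>

definition hyperbolic :: "('a::euclidean_space \<Rightarrow> real) \<Rightarrow> 'a \<Rightarrow> bool" where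
  "hyperbolic r e \<longleftrightarrow>
     (\<exists>d. homogeneous_form d r) \<and> r e > 0 \<and>
     (\<forall>v. \<exists>q :: real poly. (\<forall>t. poly q t = r (v + t *\<^sub>R e)) \<and>
        (\<forall>z :: complex. poly (map_poly complex_of_real q) z = 0 \<longrightarrow> z \<in> \<real>))"

definition symmetric_real_mat :: "nat \<Rightarrow> real mat \<Rightarrow> bool" where
  "symmetric_real_mat D M \<longleftrightarrow> M \<in> carrier_mat D D \<and> transpose_mat M = M"

definition positive_definite :: "nat \<Rightarrow> real mat \<Rightarrow> bool" where
  "positive_definite D M \<longleftrightarrow> symmetric_real_mat D M \<and>
     (\<forall>w \<in> carrier_vec D. w \<noteq> 0\<^sub>v D \<longrightarrow> 0 < scalar_prod w (M *\<^sub>v w))"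

text \<open>The matrix \<open>\<Sum>b. (v \<bullet> b) A b\<close>, written entrywise.\<close>

definition pencil :: "nat \<Rightarrow> ('a::euclidean_space \<Rightarrow> real mat) \<Rightarrow> 'a \<Rightarrow> real mat" where
  "pencil D A v = Matrix.mat D D (\<lambda>ij. \<Sum>b\<in>Basis. inner v b * (A b $$ ij))"

text \<open>For \<open>r \<noteq> 0\<close> the number \<open>D\<close> is determined by \<open>r\<close>: it is its degree. Hyperbolicity
  of \<open>r\<close> is not required separately.\<close>

definition definite_determinantal_rep :: "('a::euclidean_space \<Rightarrow> real) \<Rightarrow> 'a \<Rightarrow> bool" where
  "definite_determinantal_rep r e \<longleftrightarrow>
     (\<exists>D A. homogeneous_form D r \<and>
        (\<forall>b\<in>Basis. symmetric_real_mat D (A b)) \<and>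
        (\<forall>v. r v = Determinant.det (pencil D A v)) \<and>
        positive_definite D (pencil D A e))"

text \<open>
  The vertex \<open>(k, s, t)\<close> of the icosahedron is the point of \<open>\<real>\<^sup>3\<close> whose coordinates number
  \<open>k\<close>, \<open>k + 1\<close>, \<open>k + 2\<close> (cyclically) are \<open>0\<close>, \<open>\<plusminus>1\<close>, \<open>\<plusminus>\<phi>\<close>, where \<open>\<phi>\<close> is the golden ratio, and the
  Booleans \<open>s\<close>, \<open>t\<close> give the two signs. Two vertices are adjacent if and only if they have distance \<open>2\<close>,
  the edge length; see \<open>icosahedron_edges_iff_dist\<close>.
\<close>

type_synonym icosahedron_vertex = "3 \<times> bool \<times> bool"

definition icosahedron_edges :: "icosahedron_vertex set set" where
  "icosahedron_edges =
     {{(k, s, t), (k, \<not> s, t)} | k s t. True} \<union>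
     {{(k, s, t), (k + 1, t, u)} | k s t u. True}"

definition icosahedron_point :: "icosahedron_vertex \<Rightarrow> real ^ 3" where
  "icosahedron_point = (\<lambda>(k, s, t). \<chi> m.
     if m = k then 0
     else if m = k + 1 then (if s then 1 else - 1)
     else (if t then 1 else - 1) * ((1 + sqrt 5) / 2))"

lemma icosahedron_edges_iff: "{(k, s, t), (k', s', t')} \<in> icosahedron_edges \<longleftrightarrow>
      (k = k' \<and> s \<noteq> s' \<and> t = t') \<or> (k' = k + 1 \<and> s' = t) \<or> (k = k' + 1 \<and> s = t')"
proof -
  have A: "{(k, s, t), (k', s', t')} \<in> {{(k, s, t), (k, \<not> s, t)} | (k::3) (s::bool) (t::bool). True}
      \<longleftrightarrow> k = k' \<and> s \<noteq> s' \<and> t = t'"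
    unfolding mem_Collect_eq doubleton_eq_iff prod.inject by (cases s; cases s') auto
  have B: "{(k, s, t), (k', s', t')} \<in> {{(k, s, t), (k + 1, t, u)} | (k::3) (s::bool) (t::bool) (u::bool). True}
      \<longleftrightarrow> (k' = k + 1 \<and> s' = t) \<or> (k = k' + 1 \<and> s = t')"
    unfolding mem_Collect_eq doubleton_eq_iff prod.inject by blast
  show ?thesis unfolding icosahedron_edges_def Un_iff A B ..
qed

lemma icosahedron_edges_iff_dist:
  "{i, j} \<in> icosahedron_edges \<longleftrightarrow> dist (icosahedron_point i) (icosahedron_point j) = 2"
proof -
  define g :: real where "g = (1 + sqrt 5) / 2"
  have g: "g * g = g + 1" by (simp add: g_def field_simps)
  have g1: "g > 1" unfolding g_def by (simp add: real_less_rsqrt)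
  obtain k s t where i: "i = (k, s, t)" by (cases i) auto
  obtain k' s' t' where j: "j = (k', s', t')" by (cases j) auto
  have dist: "dist (icosahedron_point i) (icosahedron_point j) = 2 \<longleftrightarrow>
      (dist (icosahedron_point i) (icosahedron_point j))\<^sup>2 = 4"
    using power2_eq_iff_nonneg[of "dist (icosahedron_point i) (icosahedron_point j)" 2] by simp
  have sum: "(dist (icosahedron_point i) (icosahedron_point j))\<^sup>2 =
      (\<Sum>m\<in>UNIV. (vec_nth (icosahedron_point i) m - vec_nth (icosahedron_point j) m)\<^sup>2)"
    by (simp add: dist_vec_def L2_set_def dist_real_def sum_nonneg)
  show ?thesis
    unfolding dist sum unfolding i j icosahedron_edges_iff icosahedron_point_def g_def[symmetric] sum_3
    using exhaust_3[of k] exhaust_3[of k'] g g1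
    by (elim disjE; simp add: power2_eq_square algebra_simps)
qed

lemma card_icosahedron_vertices: "CARD(icosahedron_vertex) = 12"
  by simp

lemma card_icosahedron_edges: "card icosahedron_edges = 30"
proof -
  let ?f = "\<lambda>(k :: 3, t :: bool). {(k, True, t), (k, False, t)}"
  let ?g = "\<lambda>(k :: 3, s :: bool, t :: bool, u :: bool). {(k, s, t), (k + 1, t, u)}"
  have three: "k + 1 \<noteq> k" "k + 1 + 1 \<noteq> k" for k :: 3
    by (rule disjE[OF exhaust_3[of k]]; force)+
  have f: "{{(k, s, t), (k, \<not> s, t)} | (k::3) (s::bool) (t::bool). True} = range ?f"
  proof (intro equalityI subsetI)
    fix e :: "icosahedron_vertex set"
    assume "e \<in> {{(k, s, t), (k, \<not> s, t)} | k s t. True}"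
    then obtain k s t where "e = {(k, s, t), (k, \<not> s, t)}" by blast
    then have "e = ?f (k, t)" by (cases s) auto
    then show "e \<in> range ?f" by (rule range_eqI)
  next
    fix e assume "e \<in> range ?f"
    then obtain k t where "e = {(k, True, t), (k, \<not> True, t)}" by auto
    then show "e \<in> {{(k, s, t), (k, \<not> s, t)} | k s t. True}" by blast
  qed
  have g: "{{(k, s, t), (k + 1, t, u)} | (k::3) (s::bool) (t::bool) (u::bool). True} = range ?g"
    unfolding image_def by simp
  have inj_f: "inj ?f"
    by (rule injI) (clarsimp simp: doubleton_eq_iff)
  have inj_g: "inj ?g"
  proof (rule injI)
    fix p q :: "3 \<times> bool \<times> bool \<times> bool" assume "?g p = ?g q"
    moreover obtain k s t u where p: "p = (k, s, t, u)" by (rule prod_cases4)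
    moreover obtain k' s' t' u' where q: "q = (k', s', t', u')" by (rule prod_cases4)
    ultimately have "(k, s, t) = (k', s', t') \<and> (k + 1, t, u) = (k' + 1, t', u') \<or>
        (k, s, t) = (k' + 1, t', u') \<and> (k + 1, t, u) = (k', s', t')"
      by (simp only: doubleton_eq_iff prod.case)
    then show "p = q"
    proof
      assume "(k, s, t) = (k' + 1, t', u') \<and> (k + 1, t, u) = (k', s', t')"
      then have "k' + 1 + 1 = k'" unfolding prod.inject by blast
      then show ?thesis using three(2) by (rule notE[rotated])
    qed (simp add: p q)
  qed
  have fg: "?f p \<noteq> ?g q" for p q
  proof -
    obtain k t where p: "p = (k, t)" by (rule prod.exhaust)
    obtain k' s' t' u' where q: "q = (k', s', t', u')" by (rule prod_cases4)
    have "fst ` ?f p = {k}" "fst ` ?g q = {k', k' + 1}" by (simp_all add: p q)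
    then show ?thesis using three(1)[of k'] by (metis insertI1 insertI2 singletonD)
  qed
  have disjoint: "range ?f \<inter> range ?g = {}"
  proof (rule equals0I)
    fix e assume "e \<in> range ?f \<inter> range ?g"
    then obtain p q where "e = ?f p" "e = ?g q" by (elim IntE rangeE)
    then show False using fg[of p q] by argo
  qed
  have "card (range ?f) = 6"
    by (subst card_image[OF inj_f]) simp
  moreover have "card (range ?g) = 24"
    by (subst card_image[OF inj_g]) simp
  moreover have "card (range ?f \<union> range ?g) = card (range ?f) + card (range ?g)"
    by (rule card_Un_disjoint[OF finite finite disjoint])
  ultimately show ?thesis
    unfolding icosahedron_edges_def f g by linarith
qed

lemma card_icosahedron_edge_ends: "e \<in> icosahedron_edges \<Longrightarrow> card e = 2"
  by (auto simp: icosahedron_edges_def)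

typedef icosahedron_edge = icosahedron_edges
  morphisms ends Abs_icosahedron_edge
  by (auto simp: icosahedron_edges_def)

instance icosahedron_edge :: finite
proof
  show "finite (UNIV :: icosahedron_edge set)"
    using finite_imageD[OF _ inj_on_subset[OF _ subset_UNIV], of ends UNIV] ends_inject
    by (meson finite finite_imageD injI)
qed

text \<open>A point \<open>(x\<^sub>0, x, y)\<close> of the space \<open>\<real> \<times> \<real>\<^sup>1\<^sup>2 \<times> \<real>\<^sup>3\<^sup>0\<close> of dimension \<open>43\<close>.\<close>

type_synonym icosahedron_space =
  "real \<times> (real ^ icosahedron_vertex) \<times> (real ^ icosahedron_edge)"

text \<open>As \<open>ends e\<close> has exactly two elements \<open>i\<close> and \<open>j\<close>, the inner product below is \<open>x\<^sub>i x\<^sub>j\<close>.\<close>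

definition icosahedron_cubic :: "icosahedron_space \<Rightarrow> real" where
  "icosahedron_cubic = (\<lambda>(x0, x, y).
     x0 ^ 3 - 3 * x0 * ((norm x)\<^sup>2 + (norm y)\<^sup>2)
     + 9 * (\<Sum>e\<in>UNIV. (\<Prod>i\<in>ends e. vec_nth x i) * vec_nth y e))"

definition e0 :: icosahedron_space where
  "e0 = (1, 0, 0)"

lemma card_icosahedron_edge: "CARD(icosahedron_edge) = 30"
  using type_definition.card[OF type_definition_icosahedron_edge] card_icosahedron_edges by simp

lemma DIM_icosahedron_space: "DIM(icosahedron_space) = 43"
  by (simp add: card_icosahedron_edge)

end

theory Submission
  imports Defs "Jordan_Normal_Form.Schur_Decomposition"
begin

text \<open>Write \<open>n = \<parallel>x\<parallel>\<^sup>2 + \<parallel>y\<parallel>\<^sup>2\<close> and \<open>q = \<Sum> x\<^sub>i x\<^sub>j y\<^sub>i\<^sub>j\<close> (sum over the edges), so that the cubic is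
\<open>x\<^sub>0^3 - 3 n x\<^sub>0 + 9 q\<close>.

Hyperbolicity. A cubic \<open>t^3 - 3 n t + 2 r\<close> has only real zeros as soon as \<open>r^2 \<le> n^3\<close>. Here
\<open>r = 9 q / 2\<close>, and the bound follows from the Cauchy-Schwarz inequality in \<open>y\<close>, the Motzkin-Straus
inequality \<open>\<Sum> x\<^sub>i^2 x\<^sub>j^2 \<le> \<parallel>x\<parallel>^4 / 3\<close> (the icosahedron contains no four mutually adjacent vertices) and
the inequality between arithmetic and geometric mean; see \<open>cubic_bound\<close>.

No determinantal representation. Suppose the \<open>l\<close>-th power is a determinant, and normalize by a congruence
so that the matrix of \<open>x\<^sub>0\<close> is the identity. Then \<open>v = (x, y)\<close> is represented by a symmetric matrix \<open>N v\<close>,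
linear in \<open>v\<close>, with characteristic polynomial \<open>(t^3 - 3 n t - 9 q)^l\<close>. This fixes the traces of the first
four powers of \<open>N v\<close> (\<open>determinantal_rep_traces\<close>). Put \<open>C v v = (N v)^2 - 2 n\<close>. For the
trace inner product divided by \<open>6 l\<close>, these traces say that \<open>N v\<close> and \<open>C v v\<close> have the Gram matrix
with rows \<open>(n, 9 q / 2)\<close> and \<open>(9 q / 2, n^2)\<close>.
Polarizing in \<open>v\<close> gives linear relations between the inner products of the matrices
\<open>u a\<close> (the value of \<open>N\<close> at the \<open>a\<close>-th coordinate vector) and \<open>c a b\<close> (the polarized \<open>C\<close>); they are
listed in the locale \<open>icosahedral_gram\<close>.

These relations are contradictory, by duality for semidefinite programs. Take a positive
semidefinite matrix \<open>\<Lambda>\<close> indexed by the \<open>42\<close> vertices and edges. Then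
\<open>0 \<le> \<Sum> \<Lambda>\<^sub>a\<^sub>b \<langle>c a a, c b b\<rangle>\<close>, and \<open>\<langle>c a a, c b b\<rangle> = 1 - 2 \<parallel>c a b\<parallel>\<^sup>2\<close> for \<open>a \<noteq> b\<close>, so that
\<open>2 \<Sum> \<Lambda>\<^sub>a\<^sub>b \<parallel>c a b\<parallel>\<^sup>2\<close> (over \<open>a \<noteq> b\<close>) is at most the sum of all entries of \<open>\<Lambda>\<close>. In the other direction the remaining
relations bound weighted sums of the \<open>\<parallel>c a b\<parallel>\<^sup>2\<close> from below, by combining the five edges at each vertex
(\<open>star_bound\<close>), the three vertex-edge pairs in each triangle, and each edge with the two paths of length two
around it (\<open>edge_bound\<close>). A suitable integral \<open>\<Lambda>\<close> makes the lower bound exceed the upper one.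
The example is delicate: the two bounds differ by less than one part in a thousand.\<close>

section \<open>Moment matrix\<close>

text \<open>The vertices of the icosahedron are numbered \<open>0, \<dots>, 11\<close>: the vertex \<open>(k, s, t)\<close> gets the number
\<open>4 k + 2 s + t\<close>. This is the adjacency relation in these numbers.\<close>

definition ico_adj :: "nat \<Rightarrow> nat \<Rightarrow> bool" where
  "ico_adj m n \<longleftrightarrow>
     (m div 4 = n div 4 \<and> (m div 2) mod 2 \<noteq> (n div 2) mod 2 \<and> m mod 2 = n mod 2) \<or>
     (n div 4 = (m div 4 + 1) mod 3 \<and> (n div 2) mod 2 = m mod 2) \<or>
     (m div 4 = (n div 4 + 1) mod 3 \<and> (m div 2) mod 2 = n mod 2)"

text \<open>Graph distance; \<open>m\<close> and \<open>n\<close> are antipodal if and only if they share \<open>k\<close> and both signs differ.\<close>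

definition ico_dist :: "nat \<Rightarrow> nat \<Rightarrow> nat" where
  "ico_dist m n = (if m = n then 0 else if ico_adj m n then 1
     else if m div 4 = n div 4 \<and> m mod 4 + n mod 4 = 3 then 3 else 2)"

text \<open>The cells are the \<open>12\<close> vertices, \<open>i\<close> being written \<open>(i, i)\<close>, and the \<open>30\<close> edges \<open>(i, j)\<close> with \<open>i < j\<close>.\<close>

definition cells :: "(nat \<times> nat) list" where
  "cells = map (\<lambda>i. (i, i)) [0..<12] @
     filter (\<lambda>(i, j). i < j \<and> ico_adj i j) (List.product [0..<12] [0..<12])"

text \<open>A symmetric integral matrix on the cells, invariant under the symmetries of the icosahedron: the sum of the four
distances between the end points of two cells, together with the dimensions of the cells, determines the orbit of
the pair. The values are rounded from the square root of a numerical optimum of the semidefinite program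
described above, perturbed so that the square has no negative entries.\<close>

fun root_entry :: "nat \<times> nat \<Rightarrow> nat \<times> nat \<Rightarrow> int" where
  "root_entry (i, j) (k, l) =
     (let d = ico_dist i k + ico_dist i l + ico_dist j k + ico_dist j l in
      if i = j \<and> k = l then (if d = 0 then 275 else if d = 4 then 83 else if d = 8 then - 20 else 26)
      else if i = j \<or> k = l then
        (if d = 2 then 45 else if d = 4 then 18 else if d = 6 then - 10 else if d = 8 then 5 else 1)
      else (if d = 2 then 79 else if d = 3 then 18 else if d = 4 then - 5 else if d = 5 then - 9
        else if d = 6 then 5 else if d = 7 then - 2 else if d = 8 then 5 else if d = 9 then 0 else - 6))"

text \<open>Lower bounds for the entries of the square of \<^const>\<open>root_entry\<close>. They are nonzero only for two distinct
cells that are faces of a common triangle: \<open>55454\<close> for adjacent vertices, \<open>22912\<close> for a vertex and an edge through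
it, \<open>12981\<close> for a vertex and the opposite edge of a triangle, \<open>6106\<close> for two edges of a triangle. The inequalities
\<open>22912 / 12981 > (1 + sqrt 5) / 2\<close> and \<open>55454 * 6106 > 2 * 12981\<^sup>2\<close> make the forms in \<open>pentagon_form\<close> and \<open>edge_form\<close>
nonnegative.\<close>

definition threshold :: "nat \<times> nat \<Rightarrow> nat \<times> nat \<Rightarrow> int" where
  "threshold = (\<lambda>(i, j) (k, l).
     if i = j then
       if k = l then of_bool (ico_adj i k) * 55454
       else of_bool (i = k \<or> i = l) * 22912 + of_bool (ico_adj i k \<and> ico_adj i l) * 12981
     else
       if k = l then of_bool (k = i \<or> k = j) * 22912 + of_bool (ico_adj k i \<and> ico_adj k j) * 12981
       else (of_bool (i = k \<and> ico_adj j l) + of_bool (i = l \<and> ico_adj j k)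
           + of_bool (j = k \<and> ico_adj i l) + of_bool (j = l \<and> ico_adj i k)) * 6106)"

fun list_dot :: "int list \<Rightarrow> int list \<Rightarrow> int" where
  "list_dot (x # xs) (y # ys) = x * y + list_dot xs ys"
| "list_dot _ _ = 0"

definition root_row :: "nat \<times> nat \<Rightarrow> int list" where
 "root_row a = map (root_entry a) cells"

text \<open>\<open>R\<close> lists the cells together with their rows in the matrix, so that each row is evaluated only once.\<close>

definition dominates :: "((nat\<times>nat) \<times> int list) list \<Rightarrow> bool" where
 "dominates R \<longleftrightarrow> list_all (\<lambda>(a, r). list_all (\<lambda>(b, r'). threshold a b \<le> list_dot r r') R) R"

lemma root_square_total: "sum_list (map (\<lambda>k. (sum_list (map (\<lambda>a. root_entry a k) cells))^2) cells) = 10334682" by code_simp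

lemma moment_dominates: "dominates (map (\<lambda>a. (a, root_row a)) cells)"
 by code_simp

lemma list_dot_map: "list_dot (map f xs) (map g xs) = (\<Sum>x\<leftarrow>xs. f x * g x)"
  by (induction xs) auto

text \<open>The matrix \<open>\<Lambda>\<close>: the square of \<^const>\<open>root_entry\<close>, hence positive semidefinite.\<close>

definition moment :: "nat \<times> nat \<Rightarrow> nat \<times> nat \<Rightarrow> int" where
  "moment a b = (\<Sum>k\<leftarrow>cells. root_entry a k * root_entry b k)"

lemma threshold_le_moment: "a \<in> set cells \<Longrightarrow> b \<in> set cells \<Longrightarrow> threshold a b \<le> moment a b"
  using moment_dominates unfolding dominates_def by (auto simp: list_all_iff root_row_def list_dot_map moment_def)

lemma of_int_sum_list: "of_int (sum_list xs) = sum_list (map of_int xs)"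
  by (induction xs) auto

lemma sum_list_swap: "(\<Sum>x\<leftarrow>xs. \<Sum>y\<leftarrow>ys. f x y) = (\<Sum>y\<leftarrow>ys. \<Sum>x\<leftarrow>xs. (f x y :: 'a::comm_monoid_add))"
  by (induction xs) (simp_all add: sum_list_addf)

lemma moment_form:
  fixes h :: "nat \<times> nat \<Rightarrow> real"
  shows "(\<Sum>a\<leftarrow>cells. \<Sum>b\<leftarrow>cells. of_int (moment a b) * (h a * h b))
     = (\<Sum>k\<leftarrow>cells. (\<Sum>a\<leftarrow>cells. of_int (root_entry a k) * h a)\<^sup>2)"
proof -
  have "(\<Sum>k\<leftarrow>cells. (\<Sum>a\<leftarrow>cells. of_int (root_entry a k) * h a)\<^sup>2)
     = (\<Sum>k\<leftarrow>cells. \<Sum>a\<leftarrow>cells. \<Sum>b\<leftarrow>cells. (of_int (root_entry a k) * h a) * (of_int (root_entry b k) * h b))"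
    by (simp add: power2_eq_square sum_list_const_mult sum_list_mult_const)
  also have "\<dots> = (\<Sum>a\<leftarrow>cells. \<Sum>k\<leftarrow>cells. \<Sum>b\<leftarrow>cells. (of_int (root_entry a k) * h a) * (of_int (root_entry b k) * h b))"
    by (rule sum_list_swap)
  also have "\<dots> = (\<Sum>a\<leftarrow>cells. \<Sum>b\<leftarrow>cells. \<Sum>k\<leftarrow>cells. (of_int (root_entry a k) * h a) * (of_int (root_entry b k) * h b))"
    by (subst sum_list_swap) (rule refl)
  also have "\<dots> = (\<Sum>a\<leftarrow>cells. \<Sum>b\<leftarrow>cells. of_int (moment a b) * (h a * h b))"
    unfolding moment_def by (simp add: of_int_sum_list sum_list_const_mult mult_ac o_def)
  finally show ?thesis ..
qed

lemma moment_total: "(\<Sum>a\<leftarrow>cells. \<Sum>b\<leftarrow>cells. real_of_int (moment a b)) = 10334682"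
proof -
  have "(\<Sum>a\<leftarrow>cells. \<Sum>b\<leftarrow>cells. real_of_int (moment a b))
     = real_of_int (\<Sum>k\<leftarrow>cells. (\<Sum>a\<leftarrow>cells. root_entry a k)\<^sup>2)"
    using moment_form[of "\<lambda>_. 1"] by (simp add: of_int_sum_list o_def)
  then show ?thesis unfolding root_square_total by simp
qed

section \<open>Edge and triangle sums\<close>

lemma ico_adj_sym: "ico_adj i j = ico_adj j i"
proof -
  have "(p = q \<and> x \<noteq> y \<and> s = t) \<or> (q = f p \<and> y = s) \<or> (p = f q \<and> x = t) \<longleftrightarrow>
     (q = p \<and> y \<noteq> x \<and> t = s) \<or> (p = f q \<and> x = t) \<or> (q = f p \<and> y = s)"
    for p q x y s t :: nat and f by blast
  then show ?thesis unfolding ico_adj_def by this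
qed

lemma ico_adj_irrefl: "\<not> ico_adj i i"
proof -
  have "k \<noteq> (k + 1) mod 3" for k :: nat by presburger
  then show ?thesis unfolding ico_adj_def by blast
qed

definition adj01 :: "nat \<Rightarrow> nat \<Rightarrow> real" where
  "adj01 i j = of_bool (ico_adj i j)"

lemma adj01_sym: "adj01 i j = adj01 j i"
  by (simp add: adj01_def ico_adj_sym)

lemma sum_list_product: "(\<Sum>x\<leftarrow>List.product xs ys. f x) = (\<Sum>x\<leftarrow>xs. \<Sum>y\<leftarrow>ys. (f (x, y) :: 'a::comm_monoid_add))"
  by (induction xs) (simp_all add: o_def)

text \<open>Sum over all ordered pairs of adjacent vertices.\<close>

definition asum :: "(nat \<Rightarrow> nat \<Rightarrow> real) \<Rightarrow> real" where
  "asum f = (\<Sum>i<12. \<Sum>j<12. adj01 i j * f i j)"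

text \<open>Indicator function of the ordered triangles; \<open>tsum\<close> sums over them.\<close>

definition tri :: "nat \<Rightarrow> nat \<Rightarrow> nat \<Rightarrow> real" where
  "tri i j k = of_bool (ico_adj i j \<and> ico_adj j k \<and> ico_adj i k)"

definition tsum :: "(nat \<Rightarrow> nat \<Rightarrow> nat \<Rightarrow> real) \<Rightarrow> real" where
  "tsum f = (\<Sum>i<12. \<Sum>j<12. \<Sum>k<12. tri i j k * f i j k)"

lemma tri_swap12: "tri i j k = tri j i k" and tri_swap23: "tri i j k = tri i k j"
  unfolding tri_def using ico_adj_sym[of i j] ico_adj_sym[of j k] by (simp_all add: conj_ac)

text \<open>A sum over the cells, with each edge counted once, is expressed by sums over vertices and over ordered edges.\<close>

lemma sum_cells:
  assumes sym: "\<And>i j. f (i, j) = f (j, i)"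
  shows "(\<Sum>a\<leftarrow>cells. f a) = (\<Sum>i<12. f (i, i)) + asum (\<lambda>i j. f (i, j)) / 2"
proof -
  have up: "(\<Sum>x\<leftarrow>[0..<12]. h x) = (\<Sum>x<12. h x)" for h :: "nat \<Rightarrow> real"
    by (simp add: interv_sum_list_conv_sum_set_nat atLeast0LessThan)
  have filt: "(\<Sum>a\<leftarrow>filter P xs. f a) = (\<Sum>a\<leftarrow>xs. of_bool (P a) * f a)" for P and xs :: "(nat \<times> nat) list"
    by (induction xs) auto
  have "(\<Sum>a\<leftarrow>cells. f a) = (\<Sum>i<12. f (i, i)) + (\<Sum>i<12. \<Sum>j<12. of_bool (i < j \<and> ico_adj i j) * f (i, j))"
    unfolding cells_def by (simp add: filt sum_list_product up o_def case_prod_beta)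
  moreover have "(\<Sum>i<12. \<Sum>j<12. of_bool (i < j \<and> ico_adj i j) * f (i, j))
      = (\<Sum>i<12. \<Sum>j<12. of_bool (j < i \<and> ico_adj i j) * f (i, j))"
    by (subst sum.swap) (simp add: sym[of _ _] ico_adj_sym)
  moreover have "asum (\<lambda>i j. f (i, j)) = (\<Sum>i<12. \<Sum>j<12. of_bool (i < j \<and> ico_adj i j) * f (i, j))
      + (\<Sum>i<12. \<Sum>j<12. of_bool (j < i \<and> ico_adj i j) * f (i, j))"
    unfolding asum_def sum.distrib[symmetric] adj01_def
    by (intro sum.cong refl) (auto simp: ico_adj_irrefl neq_iff of_bool_def dest: less_asym)
  ultimately show ?thesis by simp
qed

lemma tsum_swap12: "tsum f = tsum (\<lambda>i j k. f j i k)"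
  unfolding tsum_def by (subst sum.swap, subst tri_swap12, rule refl)

lemma tsum_swap23: "tsum f = tsum (\<lambda>i j k. f i k j)"
  unfolding tsum_def
  by (rule sum.cong[OF refl], subst sum.swap, subst tri_swap23, rule refl)

lemma asum_swap: "asum f = asum (\<lambda>i j. f j i)"
  unfolding asum_def by (subst sum.swap, subst adj01_sym, rule refl)

lemma tsum_add: "tsum (\<lambda>i j k. f i j k + g i j k) = tsum f + tsum g"
  unfolding tsum_def by (simp add: sum.distrib algebra_simps)

lemma tsum_cmult: "tsum (\<lambda>i j k. c * f i j k) = c * tsum f"
  unfolding tsum_def by (simp add: sum_distrib_left mult_ac)

lemma asum_cmult: "asum (\<lambda>i j. c * f i j) = c * asum f"
  unfolding asum_def by (simp add: sum_distrib_left mult_ac)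

lemma asum_add: "asum (\<lambda>i j. f i j + g i j) = asum f + asum g"
  unfolding asum_def by (simp add: sum.distrib algebra_simps)

lemma asum_divide: "asum (\<lambda>i j. f i j / c) = asum f / c"
  unfolding asum_def by (simp add: sum_divide_distrib)

lemma delta_sum: fixes j :: nat shows "j < 12 \<Longrightarrow> (\<Sum>i<12. of_bool (i = j) * h i) = (h j :: real)"
  "j < 12 \<Longrightarrow> (\<Sum>i<12. of_bool (j = i) * h i) = (h j :: real)"
  by (simp_all add: of_bool_def if_distrib[of "\<lambda>x. x * _"] cong: if_cong)

lemma tsum_mono:
  assumes "\<And>i j k. i < 12 \<Longrightarrow> j < 12 \<Longrightarrow> k < 12 \<Longrightarrow> ico_adj i j \<Longrightarrow> ico_adj j k \<Longrightarrow> ico_adj i k \<Longrightarrow> f i j k \<le> g i j k"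
  shows "tsum f \<le> tsum g"
  unfolding tsum_def using assms by (intro sum_mono) (auto simp: tri_def)

text \<open>\<open>ns\<close> lists the neighbours of \<open>i\<close> in cyclic order: each is adjacent exactly to its two cyclic neighbours in the list.\<close>

definition pentagon :: "nat \<Rightarrow> nat list \<Rightarrow> bool" where
  "pentagon i ns \<longleftrightarrow> (case ns of [a, b, c, d, e] \<Rightarrow> distinct ns \<and>
     list_all (\<lambda>k. k < 12) ns \<and> list_all (\<lambda>k. ico_adj i k \<longleftrightarrow> k \<in> set ns) [0..<12] \<and>
     ico_adj a b \<and> ico_adj b c \<and> ico_adj c d \<and> ico_adj d e \<and> ico_adj e a \<and>
     \<not> ico_adj a c \<and> \<not> ico_adj b d \<and> \<not> ico_adj c e \<and> \<not> ico_adj d a \<and> \<not> ico_adj e b | _ \<Rightarrow> False)"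

text \<open>The neighbours of the vertices \<open>0, \<dots>, 11\<close>, each list in cyclic order.\<close>

definition links :: "nat list list" where
  "links = [[2,4,8,10,5],[3,6,8,10,7],[0,4,9,11,5],[1,6,9,11,7],[0,2,9,6,8],[0,2,11,7,10],[1,3,9,4,8],[1,3,11,5,10],[0,4,6,1,10],[2,4,6,3,11],[0,5,7,1,8],[2,5,7,3,9]]"

lemma pentagon_links: "list_all (\<lambda>(i, ns). pentagon i ns) (zip [0..<12] links)"
  by code_simp

lemma vertex_link:
  assumes "i < 12"
  obtains a b c d e where "distinct [a, b, c, d, e]" "{..<12} \<inter> {k. ico_adj i k} = {a, b, c, d, e}"
     "ico_adj a b" "ico_adj b c" "ico_adj c d" "ico_adj d e" "ico_adj e a"
     "\<not> ico_adj a c" "\<not> ico_adj b d" "\<not> ico_adj c e" "\<not> ico_adj d a" "\<not> ico_adj e b"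
proof -
  have "(i, links ! i) \<in> set (zip [0..<12] links)"
    using assms by (auto simp: set_zip links_def intro!: exI[of _ i])
  then obtain ns where "pentagon i ns" using pentagon_links unfolding list_all_iff by blast
  then obtain a b c d e where ns: "ns = [a, b, c, d, e]" and p: "pentagon i [a, b, c, d, e]"
    unfolding pentagon_def by (auto split: list.splits)
  have "{..<12} \<inter> {k. ico_adj i k} = {a, b, c, d, e}"
  proof -
    have "\<forall>k\<in>{0..<12}. ico_adj i k \<longleftrightarrow> k \<in> set [a, b, c, d, e]" "\<forall>k\<in>set [a, b, c, d, e]. k < 12"
      using p unfolding pentagon_def list.case list_all_iff set_upt by blast+
    then show ?thesis unfolding list.set by fastforce
  qed
  then show ?thesis using p that unfolding pentagon_def list.case by blast
qed

text \<open>The quadratic form on the right is invariant under rotations of the pentagon and \<open>(1, 1, 1, 1, 1)\<close> is an eigenvector.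
On its complement the form is nonnegative, because \<open>22912 / 12981\<close> exceeds the golden ratio.\<close>

lemma pentagon_form:
  fixes a b c d e :: real
  shows "(48874 / 5) * (a + b + c + d + e)\<^sup>2 \<le>
     22912 * (a\<^sup>2 + b\<^sup>2 + c\<^sup>2 + d\<^sup>2 + e\<^sup>2) + 2 * 12981 * (a * b + b * c + c * d + d * e + e * a)"
proof -
  have scale: "48874 / 5 * u \<le> v" if "5 * v - 48874 * u \<ge> 0" for u v :: real
    using that by simp
  \<comment> \<open>The first five squares are those of the sides of the pentagram, the others their second differences.\<close>
  have "5 * (22912 * (a\<^sup>2 + b\<^sup>2 + c\<^sup>2 + d\<^sup>2 + e\<^sup>2) + 2 * 12981 * (a * b + b * c + c * d + d * e + e * a))
     - 48874 * (a + b + c + d + e)\<^sup>2 =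
     781 * ((a - c)\<^sup>2 + (c - e)\<^sup>2 + (e - b)\<^sup>2 + (b - d)\<^sup>2 + (d - a)\<^sup>2) +
     16031 / 5 * ((a - 3 * c + 3 * e - b)\<^sup>2 + (c - 3 * e + 3 * b - d)\<^sup>2 + (e - 3 * b + 3 * d - a)\<^sup>2
       + (b - 3 * d + 3 * a - c)\<^sup>2 + (d - 3 * a + 3 * c - e)\<^sup>2)"
    by (simp add: power2_eq_square field_simps)
  moreover have "\<dots> \<ge> 0" by (intro add_nonneg_nonneg mult_nonneg_nonneg) auto
  ultimately show ?thesis by (intro scale) presburger
qed

lemma vertex_link_sum:
  assumes "i < 12"
  obtains a b c d e where "\<forall>h. (\<Sum>j<12. adj01 i j * h j) = h a + h b + h c + h d + (h e :: real)"
     "{..<12} \<inter> {k. ico_adj i k} = {a, b, c, d, e}"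
     "adj01 a b = 1" "adj01 b c = 1" "adj01 c d = 1" "adj01 d e = 1" "adj01 e a = 1"
     "adj01 b a = 1" "adj01 c b = 1" "adj01 d c = 1" "adj01 e d = 1" "adj01 a e = 1"
     "adj01 a c = 0" "adj01 b d = 0" "adj01 c e = 0" "adj01 d a = 0" "adj01 e b = 0"
     "adj01 c a = 0" "adj01 d b = 0" "adj01 e c = 0" "adj01 a d = 0" "adj01 b e = 0"
proof -
  obtain a b c d e where dist: "distinct [a, b, c, d, e]" and nb: "{..<12} \<inter> {k. ico_adj i k} = {a, b, c, d, e}"
    and adj: "ico_adj a b" "ico_adj b c" "ico_adj c d" "ico_adj d e" "ico_adj e a"
    and nadj: "\<not> ico_adj a c" "\<not> ico_adj b d" "\<not> ico_adj c e" "\<not> ico_adj d a" "\<not> ico_adj e b"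
    using vertex_link[OF assms] .
  have S: "(\<Sum>j<12. adj01 i j * h j) = h a + h b + h c + h d + h e" for h :: "nat \<Rightarrow> real"
  proof -
    have "(\<Sum>j<12. adj01 i j * h j) = (\<Sum>j\<in>{..<12} \<inter> {k. ico_adj i k}. h j)"
      unfolding sum.inter_restrict[OF finite_lessThan] adj01_def by (intro sum.cong refl) auto
    also have "\<dots> = h a + h b + h c + h d + h e"
      unfolding nb using dist by simp
    finally show ?thesis .
  qed
  have adj': "adj01 a b = 1" "adj01 b c = 1" "adj01 c d = 1" "adj01 d e = 1" "adj01 e a = 1"
    and nadj': "adj01 a c = 0" "adj01 b d = 0" "adj01 c e = 0" "adj01 d a = 0" "adj01 e b = 0"
    using adj nadj by (simp_all add: adj01_def)
  show ?thesis
    using adj' nadj' by (intro that[OF allI[OF S] nb]) (simp_all add: adj01_sym[of b a] adj01_sym[of c b] adj01_sym[of d c]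
      adj01_sym[of e d] adj01_sym[of a e] adj01_sym[of c a] adj01_sym[of d b] adj01_sym[of e c] adj01_sym[of a d] adj01_sym[of b e])
qed

lemma adj01_self: "adj01 i i = 0"
  by (simp add: adj01_def ico_adj_irrefl)

lemma tri_adj01: "tri i j k = adj01 i j * adj01 i k * adj01 j k"
  by (auto simp: tri_def adj01_def)

lemma degree_5:
  assumes "i < 12"
  shows "(\<Sum>j<12. adj01 i j) = 5"
proof -
  obtain a b c d e where S: "\<forall>h. (\<Sum>j<12. adj01 i j * h j) = h a + h b + h c + h d + (h e :: real)"
    by (rule vertex_link_sum[OF assms]) (rule that)
  show ?thesis using S[rule_format, of "\<lambda>_. 1"] by simp
qed

lemma common_neighbours:
  assumes "i < 12" "j < 12" "ico_adj i j"
  shows "(\<Sum>k<12. tri i j k) = 2"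
proof -
  obtain a b c d e where S: "\<forall>h. (\<Sum>j<12. adj01 i j * h j) = h a + h b + h c + h d + (h e :: real)"
     and nb: "{..<12} \<inter> {k. ico_adj i k} = {a, b, c, d, e}"
     and adj: "adj01 a b = 1" "adj01 b c = 1" "adj01 c d = 1" "adj01 d e = 1" "adj01 e a = 1"
     "adj01 b a = 1" "adj01 c b = 1" "adj01 d c = 1" "adj01 e d = 1" "adj01 a e = 1"
     "adj01 a c = 0" "adj01 b d = 0" "adj01 c e = 0" "adj01 d a = 0" "adj01 e b = 0"
     "adj01 c a = 0" "adj01 d b = 0" "adj01 e c = 0" "adj01 a d = 0" "adj01 b e = 0"
    by (rule vertex_link_sum[OF assms(1)]) (rule that)
  have "j \<in> {a, b, c, d, e}" unfolding nb[symmetric] using assms by simp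
  then have "adj01 j a + adj01 j b + adj01 j c + adj01 j d + adj01 j e = 2"
    using adj by (auto simp: adj01_self)
  moreover have "(\<Sum>k<12. tri i j k) = (\<Sum>k<12. adj01 i k * adj01 j k)"
    using assms(3) by (simp add: tri_adj01 adj01_def)
  ultimately show ?thesis unfolding S[rule_format] by simp
qed

lemma asum_1: "asum (\<lambda>_ _. 1) = 60"
  unfolding asum_def using degree_5 by simp

text \<open>Each edge lies in two triangles.\<close>

lemma tsum_asum: "tsum (\<lambda>i j k. f i j) = 2 * asum f"
proof -
  have "(\<Sum>k<12. tri i j k * f i j) = 2 * (adj01 i j * f i j)" if "i < 12" "j < 12" for i j
  proof (cases "ico_adj i j")
    case True
    then show ?thesis using common_neighbours[OF that] by (simp add: adj01_def sum_distrib_right[symmetric])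
  qed (simp add: adj01_def tri_def)
  then show ?thesis unfolding tsum_def asum_def by (simp add: sum_distrib_left)
qed

lemma star_form:
  fixes x :: "nat \<Rightarrow> real"
  assumes "i < 12"
  shows "(48874 / 5) * (\<Sum>j<12. adj01 i j * x j)\<^sup>2 \<le>
     22912 * (\<Sum>j<12. adj01 i j * (x j)\<^sup>2) + 12981 * (\<Sum>j<12. \<Sum>k<12. tri i j k * (x j * x k))"
proof -
  obtain a b c d e where S: "\<forall>h. (\<Sum>j<12. adj01 i j * h j) = h a + h b + h c + h d + (h e :: real)"
     and nb: "{..<12} \<inter> {k. ico_adj i k} = {a, b, c, d, e}"
     and adj: "adj01 a b = 1" "adj01 b c = 1" "adj01 c d = 1" "adj01 d e = 1" "adj01 e a = 1"
     "adj01 b a = 1" "adj01 c b = 1" "adj01 d c = 1" "adj01 e d = 1" "adj01 a e = 1"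
     "adj01 a c = 0" "adj01 b d = 0" "adj01 c e = 0" "adj01 d a = 0" "adj01 e b = 0"
     "adj01 c a = 0" "adj01 d b = 0" "adj01 e c = 0" "adj01 a d = 0" "adj01 b e = 0"
    by (rule vertex_link_sum[OF assms]) (rule that)
  have "(\<Sum>j<12. \<Sum>k<12. tri i j k * (x j * x k)) = (\<Sum>j<12. adj01 i j * (\<Sum>k<12. adj01 i k * (adj01 j k * (x j * x k))))"
    unfolding sum_distrib_left tri_adj01 by (simp add: mult.assoc)
  also have "\<dots> = 2 * (x a * x b + x b * x c + x c * x d + x d * x e + x e * x a)"
    unfolding S[rule_format] adj adj01_self by simp
  finally have T: "(\<Sum>j<12. \<Sum>k<12. tri i j k * (x j * x k)) = 2 * (x a * x b + x b * x c + x c * x d + x d * x e + x e * x a)" .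
  show ?thesis unfolding S[rule_format] T using pentagon_form[of "x a" "x b" "x c" "x d" "x e"] by simp
qed

section \<open>Hyperbolicity\<close>

text \<open>If \<open>z = a + i b\<close> with \<open>b \<noteq> 0\<close> is a zero, then \<open>b\<^sup>2 = 3 (a\<^sup>2 - n)\<close> and \<open>r = a (4 a\<^sup>2 - 3 n)\<close>, so that
\<open>a\<^sup>2 > n\<close> forces \<open>r\<^sup>2 > n^3\<close>.\<close>

lemma cubic_real_rooted:
  fixes z :: complex and n r :: real
  assumes n: "n \<ge> 0" and r: "r\<^sup>2 \<le> n ^ 3"
    and z: "z ^ 3 - 3 * of_real n * z + 2 * of_real r = 0"
  shows "z \<in> \<real>"
proof (rule ccontr)
  assume "z \<notin> \<real>"
  define a b where "a = Re z" and "b = Im z"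
  have b: "b \<noteq> 0" using \<open>z \<notin> \<real>\<close> by (simp add: b_def complex_is_Real_iff)
  have zab: "z = Complex a b" by (simp add: a_def b_def)
  have im: "b * (3 * a\<^sup>2 - b\<^sup>2 - 3 * n) = 0" and re: "a ^ 3 - 3 * a * b\<^sup>2 - 3 * n * a + 2 * r = 0"
    using z unfolding zab by (simp_all add: complex_eq_iff power3_eq_cube power2_eq_square algebra_simps)
  have b2: "b\<^sup>2 = 3 * a\<^sup>2 - 3 * n" using im b by simp
  have rr: "r = a * (4 * a\<^sup>2 - 3 * n)" using re unfolding b2 by (simp add: power3_eq_cube power2_eq_square algebra_simps)
  have an: "a\<^sup>2 > n" using b2 b zero_less_power2[of b] by linarith
  have "n ^ 3 = n * n\<^sup>2" by (simp add: power3_eq_cube power2_eq_square)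
  also have "\<dots> \<le> n * (4 * a\<^sup>2 - 3 * n)\<^sup>2" using an n by (intro mult_left_mono power_mono) auto
  also have "\<dots> < a\<^sup>2 * (4 * a\<^sup>2 - 3 * n)\<^sup>2" using an n by (intro mult_strict_right_mono) auto
  also have "\<dots> = r\<^sup>2" by (simp add: rr power_mult_distrib)
  finally show False using r by simp
qed

text \<open>Three mutually adjacent neighbours of a vertex would form a triangle in the pentagon of its neighbours.\<close>

lemma no_K4:
  assumes "i < 12" "j < 12" "k < 12" "l < 12" "ico_adj i j" "ico_adj i k" "ico_adj i l"
    "ico_adj j k" "ico_adj j l" "ico_adj k l"
  shows False
proof -
  obtain a b c d e where nb: "{..<12} \<inter> {k. ico_adj i k} = {a, b, c, d, e}"
    and nadj: "\<not> ico_adj a c" "\<not> ico_adj b d" "\<not> ico_adj c e" "\<not> ico_adj d a" "\<not> ico_adj e b"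
    by (rule vertex_link[OF assms(1)]) (rule that)
  have nadj': "\<not> ico_adj c a" "\<not> ico_adj d b" "\<not> ico_adj e c" "\<not> ico_adj a d" "\<not> ico_adj b e"
    using nadj ico_adj_sym by blast+
  have "j \<in> {a, b, c, d, e}" "k \<in> {a, b, c, d, e}" "l \<in> {a, b, c, d, e}"
    unfolding nb[symmetric] using assms by auto
  then show False using nadj nadj' ico_adj_irrefl assms(8-10) by blast
qed

text \<open>Induction on the size of the support. If two vertices of the support are not adjacent, then the left hand side is
affine along the direction that shifts mass from one to the other, so all mass of one of them can be moved
without decreasing it. Otherwise the support is a clique with at most three vertices.\<close>

lemma motzkin_straus:
  fixes z :: "nat \<Rightarrow> real"
  assumes "\<And>i. i < 12 \<Longrightarrow> z i \<ge> 0"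
  shows "3 * asum (\<lambda>i j. z i * z j) \<le> 2 * (\<Sum>i<12. z i)\<^sup>2"
  using assms
proof (induction "card {i. i < 12 \<and> z i \<noteq> 0}" arbitrary: z rule: less_induct)
  case less
  define S where "S = {i. i < 12 \<and> z i \<noteq> 0}"
  have finS: "finite S" by (simp add: S_def)
  show ?case
  proof (cases "\<exists>i\<in>S. \<exists>j\<in>S. i \<noteq> j \<and> \<not> ico_adj i j")
    case True
    define N where "N i = (\<Sum>k<12. adj01 i k * z k)" for i
    obtain i j where ij: "i \<in> S" "j \<in> S" "i \<noteq> j" "\<not> ico_adj i j" "N j \<le> N i"
      using True ico_adj_sym linear[of "N _" "N _"] by metis
    then have b: "i < 12" "j < 12" "z j \<noteq> 0" by (auto simp: S_def)
    define z' where "z' = z(i := z i + z j, j := 0)"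
    define \<delta> where "\<delta> k = (of_bool (k = i) - of_bool (k = j) :: real)" for k
    have z': "z' k = z k + z j * \<delta> k" for k
      using ij by (auto simp: z'_def \<delta>_def)
    have pick: "(\<Sum>k<12. \<delta> k * h k) = h i - h j" for h :: "nat \<Rightarrow> real"
      using b unfolding \<delta>_def by (simp add: left_diff_distrib sum_subtractf of_bool_def if_distrib[of "\<lambda>x. x * _"] cong: if_cong)
    have "asum (\<lambda>k l. z' k * z' l) = asum (\<lambda>k l. z k * z l)
        + z j * asum (\<lambda>k l. \<delta> k * z l) + z j * asum (\<lambda>k l. z k * \<delta> l) + (z j)\<^sup>2 * asum (\<lambda>k l. \<delta> k * \<delta> l)"
      unfolding asum_def z' by (simp add: algebra_simps sum.distrib sum_distrib_left power2_eq_square)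
    moreover have dz: "asum (\<lambda>k l. \<delta> k * z l) = N i - N j"
    proof -
      have "asum (\<lambda>k l. \<delta> k * z l) = (\<Sum>k<12. \<delta> k * N k)"
        unfolding asum_def N_def sum_distrib_left by (intro sum.cong refl) (simp add: mult_ac)
      then show ?thesis by (simp add: pick)
    qed
    moreover have "asum (\<lambda>k l. z k * \<delta> l) = N i - N j"
      using dz by (subst asum_swap) (simp add: mult.commute)
    moreover have "asum (\<lambda>k l. \<delta> k * \<delta> l) = 0"
    proof -
      have "asum (\<lambda>k l. \<delta> k * \<delta> l) = (\<Sum>k<12. \<delta> k * (\<Sum>l<12. \<delta> l * adj01 k l))"
        unfolding asum_def sum_distrib_left by (intro sum.cong refl) (simp add: mult_ac)
      then show ?thesis
        unfolding pick using ij by (simp add: adj01_def ico_adj_irrefl ico_adj_sym)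
    qed
    moreover have "z j * (N i - N j) \<ge> 0" using less.prems[OF b(2)] ij(5) by simp
    ultimately have ge: "asum (\<lambda>k l. z k * z l) \<le> asum (\<lambda>k l. z' k * z' l)" by (simp only:)
    have "(\<Sum>k<12. z' k) = (\<Sum>k<12. z k)"
      using pick[of "\<lambda>_. 1"] by (simp add: z' sum.distrib sum_distrib_left[symmetric])
    moreover have "3 * asum (\<lambda>k l. z' k * z' l) \<le> 2 * (\<Sum>i<12. z' i)\<^sup>2"
    proof (rule less.hyps)
      have "{k. k < 12 \<and> z' k \<noteq> 0} \<subseteq> S - {j}" using ij by (auto simp: z'_def S_def split: if_splits)
      then have "card {k. k < 12 \<and> z' k \<noteq> 0} \<le> card (S - {j})" using finS by (intro card_mono) auto
      also have "\<dots> < card S" using finS ij by (intro card_Diff1_less) auto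
      finally show "card {k. k < 12 \<and> z' k \<noteq> 0} < card {i. i < 12 \<and> z i \<noteq> 0}" unfolding S_def .
      show "\<And>i. i < 12 \<Longrightarrow> 0 \<le> z' i" using less.prems b by (auto simp: z'_def)
    qed
    ultimately show ?thesis using ge by simp
  next
    case False
    then have clique: "\<And>i j. i \<in> S \<Longrightarrow> j \<in> S \<Longrightarrow> i \<noteq> j \<Longrightarrow> ico_adj i j" by blast
    have S12: "S \<subseteq> {..<12}" by (auto simp: S_def)
    have "card S \<le> 3"
    proof (rule ccontr)
      assume "\<not> card S \<le> 3"
      then have "4 \<le> card S" by simp
      then obtain T where T: "T \<subseteq> S" "card T = 4" by (rule obtain_subset_with_card_n)
      then obtain i j k l where "T = {i, j, k, l}" "distinct [i, j, k, l]"
        by (auto simp: numeral_eq_Suc card_Suc_eq)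
      then show False using no_K4[of i j k l] clique T(1) S12 by auto
    qed
    have "asum (\<lambda>i j. z i * z j) = (\<Sum>i\<in>S. \<Sum>j\<in>S. adj01 i j * (z i * z j))"
    proof -
      have "(\<Sum>j\<in>S. adj01 i j * (z i * z j)) = (\<Sum>j<12. adj01 i j * (z i * z j))" for i
        by (rule sum.mono_neutral_left) (auto simp: S_def)
      moreover have "(\<Sum>i\<in>S. (\<Sum>j<12. adj01 i j * (z i * z j))) = (\<Sum>i<12. (\<Sum>j<12. adj01 i j * (z i * z j)))"
        by (rule sum.mono_neutral_left) (auto simp: S_def)
      ultimately show ?thesis unfolding asum_def by simp
    qed
    also have "\<dots> = (\<Sum>i\<in>S. \<Sum>j\<in>S. z i * z j - of_bool (i = j) * (z i * z j))"
      using clique by (intro sum.cong refl) (auto simp: adj01_def ico_adj_irrefl)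
    also have "\<dots> = (\<Sum>i\<in>S. z i)\<^sup>2 - (\<Sum>i\<in>S. (z i)\<^sup>2)"
      using finS by (simp add: sum_subtractf power2_eq_square sum_product of_bool_def if_distrib[of "\<lambda>x. x * _"] cong: if_cong)
    finally have E: "asum (\<lambda>i j. z i * z j) = (\<Sum>i\<in>S. z i)\<^sup>2 - (\<Sum>i\<in>S. (z i)\<^sup>2)" .
    have "(\<Sum>i\<in>S. z i)\<^sup>2 \<le> (\<Sum>i\<in>S. (z i)\<^sup>2) * card S"
      by (rule sum_squared_le_sum_of_squares)
    also have "\<dots> \<le> (\<Sum>i\<in>S. (z i)\<^sup>2) * 3" using \<open>card S \<le> 3\<close> by (intro mult_left_mono sum_nonneg) auto
    finally have "3 * asum (\<lambda>i j. z i * z j) \<le> 2 * (\<Sum>i\<in>S. z i)\<^sup>2" unfolding E by simp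
    also have "(\<Sum>i\<in>S. z i) = (\<Sum>i<12. z i)"
      by (rule sum.mono_neutral_left) (auto simp: S_def)
    finally show ?thesis .
  qed
qed

text \<open>The numbering of the vertices used for \<^const>\<open>ico_adj\<close>.\<close>

definition nth_vertex :: "nat \<Rightarrow> icosahedron_vertex" where
  "nth_vertex n = (of_nat (n div 4), odd (n div 2), odd n)"

lemma of_nat_3_eq:
  assumes "m < 3" "n < 3"
  shows "(of_nat m = (of_nat n :: 3)) \<longleftrightarrow> m = n"
    and "(of_nat m = (of_nat n + 1 :: 3)) \<longleftrightarrow> m = (n + 1) mod 3"
proof -
  have three: "k = 0 \<or> k = 1 \<or> k = 2" if "k < 3" for k :: nat using that by auto
  show "(of_nat m = (of_nat n :: 3)) \<longleftrightarrow> m = n"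
    using three[OF assms(1)] three[OF assms(2)] by (elim disjE) simp_all
  show "(of_nat m = (of_nat n + 1 :: 3)) \<longleftrightarrow> m = (n + 1) mod 3"
    using three[OF assms(1)] three[OF assms(2)] by (elim disjE) simp_all
qed

lemma nth_vertex_bij: "bij_betw nth_vertex {..<12} UNIV"
proof -
  have inj: "inj_on nth_vertex {..<12}"
  proof (rule inj_onI)
    fix m n :: nat assume mn: "m \<in> {..<12}" "n \<in> {..<12}" "nth_vertex m = nth_vertex n"
    then have "m div 4 = n div 4" using of_nat_3_eq[of "m div 4" "n div 4"] by (auto simp: nth_vertex_def)
    moreover have "(m div 2) mod 2 = (n div 2) mod 2" "m mod 2 = n mod 2"
      using mn by (auto simp: nth_vertex_def odd_iff_mod_2_eq_one)
    moreover have "k = 4 * (k div 4) + 2 * (k div 2 mod 2) + k mod 2" for k :: nat by presburger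
    ultimately show "m = n" by metis
  qed
  moreover have "nth_vertex ` {..<12} = UNIV"
  proof (rule card_subset_eq)
    show "card (nth_vertex ` {..<12}) = CARD(icosahedron_vertex)" using card_image[OF inj] by simp
  qed auto
  ultimately show ?thesis by (simp add: bij_betw_def)
qed

lemma nth_vertex_edge:
  assumes "i < 12" "j < 12"
  shows "{nth_vertex i, nth_vertex j} \<in> icosahedron_edges \<longleftrightarrow> ico_adj i j"
proof -
  have "i div 4 < 3" "j div 4 < 3" using assms by auto
  note three = of_nat_3_eq[OF this] of_nat_3_eq[OF this(2,1)]
  have odd: "odd a = odd b \<longleftrightarrow> a mod 2 = b mod 2" for a b :: nat by presburger
  show ?thesis
    unfolding nth_vertex_def icosahedron_edges_iff ico_adj_def three odd by (rule refl)
qed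

lemma sum_ordered_pairs:
  fixes a b :: "'a::finite"
  assumes "a \<noteq> b"
  shows "(\<Sum>u\<in>UNIV. \<Sum>v\<in>UNIV. of_bool ({a, b} = {u, v})) = (2 :: real)"
proof -
  have "(\<Sum>u\<in>UNIV. \<Sum>v\<in>UNIV. of_bool ({a, b} = {u, v})) = (\<Sum>u\<in>UNIV. \<Sum>v\<in>UNIV.
      (if v = b then if u = a then 1 else 0 else 0) + (if v = a then if u = b then 1 else 0 else (0::real)))"
    using assms by (intro sum.cong refl) (auto simp: doubleton_eq_iff)
  then show ?thesis by (simp add: sum.distrib)
qed

lemma sum_edges:
  fixes f :: "icosahedron_vertex set \<Rightarrow> real"
  shows "(\<Sum>e\<in>UNIV. f (ends e)) = asum (\<lambda>i j. f {nth_vertex i, nth_vertex j}) / 2"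
proof -
  have nth_vertex: "(\<Sum>i<12. g (nth_vertex i)) = (\<Sum>u\<in>UNIV. g u)" for g :: "icosahedron_vertex \<Rightarrow> real"
    by (rule sum.reindex_bij_betw[OF nth_vertex_bij])
  have two: "(\<Sum>i<12. \<Sum>j<12. of_bool (ends e = {nth_vertex i, nth_vertex j})) = (2 :: real)" for e
  proof -
    obtain a b where e: "ends e = {a, b}" "a \<noteq> b"
      using card_icosahedron_edge_ends[OF ends[of e]] by (auto simp: card_2_iff)
    have "(\<Sum>i<12. \<Sum>j<12. of_bool (ends e = {nth_vertex i, nth_vertex j})) = (\<Sum>i<12. \<Sum>v\<in>UNIV. of_bool ({a, b} = {nth_vertex i, v}) :: real)"
      unfolding e by (intro sum.cong refl nth_vertex)
    also have "\<dots> = (\<Sum>u\<in>UNIV. \<Sum>v\<in>UNIV. of_bool ({a, b} = {u, v}))" by (rule nth_vertex)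
    also have "\<dots> = 2" using e(2) by (rule sum_ordered_pairs)
    finally show ?thesis .
  qed
  have "asum (\<lambda>i j. f {nth_vertex i, nth_vertex j}) = (\<Sum>i<12. \<Sum>j<12. \<Sum>e\<in>UNIV. of_bool (ends e = {nth_vertex i, nth_vertex j}) * f (ends e))"
    unfolding asum_def
  proof (intro sum.cong refl)
    fix i j :: nat assume "i \<in> {..<12}" "j \<in> {..<12}"
    then have adj: "adj01 i j = of_bool ({nth_vertex i, nth_vertex j} \<in> icosahedron_edges)"
      by (simp add: adj01_def nth_vertex_edge)
    show "adj01 i j * f {nth_vertex i, nth_vertex j} = (\<Sum>e\<in>UNIV. of_bool (ends e = {nth_vertex i, nth_vertex j}) * f (ends e))"
    proof (cases "{nth_vertex i, nth_vertex j} \<in> icosahedron_edges")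
      case True
      define d where "d = Abs_icosahedron_edge {nth_vertex i, nth_vertex j}"
      have d: "ends d = {nth_vertex i, nth_vertex j}" using True by (simp add: d_def Abs_icosahedron_edge_inverse)
      have "(\<Sum>e\<in>UNIV. of_bool (ends e = {nth_vertex i, nth_vertex j}) * f (ends e)) = (\<Sum>e\<in>UNIV. if e = d then f (ends d) else 0)"
        unfolding d[symmetric] ends_inject by (intro sum.cong refl) auto
      then show ?thesis unfolding adj using True d by simp
    next
      case False
      then have "ends e \<noteq> {nth_vertex i, nth_vertex j}" for e using ends[of e] by metis
      then show ?thesis unfolding adj using False by simp
    qed
  qed
  also have "\<dots> = (\<Sum>e\<in>UNIV. (\<Sum>i<12. \<Sum>j<12. of_bool (ends e = {nth_vertex i, nth_vertex j})) * f (ends e))"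
    unfolding sum_distrib_right by (subst (2) sum.swap, subst sum.swap, rule refl)
  finally show ?thesis unfolding two by (simp add: sum_distrib_left[symmetric])
qed

lemma cubic_bound:
  fixes x :: "real ^ icosahedron_vertex" and y :: "real ^ icosahedron_edge"
  shows "(9 / 2 * (\<Sum>e\<in>UNIV. (\<Prod>i\<in>ends e. vec_nth x i) * vec_nth y e))\<^sup>2 \<le> ((norm x)\<^sup>2 + (norm y)\<^sup>2) ^ 3"
proof -
  define z where "z i = (vec_nth x (nth_vertex i))\<^sup>2" for i
  define a b where "a = (norm x)\<^sup>2" and "b = (norm y)\<^sup>2"
  have ab: "a \<ge> 0" "b \<ge> 0" by (simp_all add: a_def b_def)
  have sq: "(norm w)\<^sup>2 = (\<Sum>i\<in>UNIV. (vec_nth w i)\<^sup>2)" for w :: "real ^ 'k::finite"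
    by (simp add: norm_vec_def L2_set_def sum_nonneg)
  have a: "a = (\<Sum>i<12. z i)"
    unfolding a_def sq z_def by (rule sum.reindex_bij_betw[OF nth_vertex_bij, symmetric])
  have inj: "nth_vertex i \<noteq> nth_vertex j" if "ico_adj i j" "i < 12" "j < 12" for i j
    using that nth_vertex_bij ico_adj_irrefl unfolding bij_betw_def inj_on_def by (metis lessThan_iff)
  have "(\<Sum>e\<in>UNIV. ((\<Prod>i\<in>ends e. vec_nth x i))\<^sup>2) = asum (\<lambda>i j. (\<Prod>i\<in>{nth_vertex i, nth_vertex j}. vec_nth x i)\<^sup>2) / 2"
    by (rule sum_edges[where f = "\<lambda>S. (\<Prod>i\<in>S. vec_nth x i)\<^sup>2"])
  also have "\<dots> = asum (\<lambda>i j. z i * z j) / 2"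
    unfolding asum_def by (intro arg_cong2[where f = divide] sum.cong refl)
      (auto simp: adj01_def z_def inj power_mult_distrib)
  finally have E: "3 * (\<Sum>e\<in>UNIV. ((\<Prod>i\<in>ends e. vec_nth x i))\<^sup>2) \<le> a\<^sup>2"
    using motzkin_straus[of z] unfolding a by (simp add: z_def)
  have "(\<Sum>e\<in>UNIV. (\<Prod>i\<in>ends e. vec_nth x i) * vec_nth y e)\<^sup>2 \<le> (\<Sum>e\<in>UNIV. (\<Prod>i\<in>ends e. vec_nth x i)\<^sup>2) * b"
    unfolding b_def sq by (rule Cauchy_Schwarz_ineq_sum)
  also have "\<dots> \<le> a\<^sup>2 / 3 * b" using E ab by (intro mult_right_mono) auto
  finally have "(9 / 2 * (\<Sum>e\<in>UNIV. (\<Prod>i\<in>ends e. vec_nth x i) * vec_nth y e))\<^sup>2 \<le> 27 / 4 * (a\<^sup>2 * b)"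
    by (simp add: power_mult_distrib power_divide mult.commute)
  moreover have "4 * (a + b) ^ 3 - 27 * (a\<^sup>2 * b) = (a - 2 * b)\<^sup>2 * (4 * a + b)"
    by (simp add: power3_eq_cube power2_eq_square algebra_simps)
  moreover have "\<dots> \<ge> 0" using ab by simp
  ultimately show ?thesis unfolding a_def[symmetric] b_def[symmetric] by linarith
qed

lemma homogeneous_icosahedron_cubic: "homogeneous_form 3 icosahedron_cubic"
  unfolding homogeneous_form_def
proof (intro conjI allI)
  have sq: "(norm w)\<^sup>2 = (\<Sum>i\<in>UNIV. (vec_nth w i)\<^sup>2)" for w :: "real ^ 'k::finite"
    by (simp add: norm_vec_def L2_set_def sum_nonneg)
  have x: "real_polynomial_function (\<lambda>v::icosahedron_space. vec_nth (fst (snd v)) i)" for i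
    by (intro real_polynomial_function.intros(1) bounded_linear_compose[OF bounded_linear_vec_nth]
        bounded_linear_compose[OF bounded_linear_fst] bounded_linear_snd)
  have y: "real_polynomial_function (\<lambda>v::icosahedron_space. vec_nth (snd (snd v)) i)" for i
    by (intro real_polynomial_function.intros(1) bounded_linear_compose[OF bounded_linear_vec_nth]
        bounded_linear_compose[OF bounded_linear_snd] bounded_linear_snd)
  have t: "real_polynomial_function (\<lambda>v::icosahedron_space. fst v)"
    by (intro real_polynomial_function.intros(1) bounded_linear_fst)
  show "real_polynomial_function icosahedron_cubic"
    unfolding icosahedron_cubic_def case_prod_beta' sq
    by (intro real_polynomial_function.intros(3) real_polynomial_function_diff real_polynomial_function_power
        real_polynomial_function.intros(4) real_polynomial_function_sum real_polynomial_function_prod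
        real_polynomial_function.intros(2) finite x y t)
  fix c and v :: icosahedron_space
  obtain t x y where v: "v = (t, x, y)" by (cases v) auto
  have P: "(\<Prod>i\<in>ends e. c * vec_nth x i) = c\<^sup>2 * (\<Prod>i\<in>ends e. vec_nth x i)" for e
    using card_icosahedron_edge_ends[OF ends[of e]] by (simp add: prod.distrib)
  have S: "(\<Sum>e\<in>UNIV. (\<Prod>i\<in>ends e. c * vec_nth x i) * (c * vec_nth y e)) =
      c ^ 3 * (\<Sum>e\<in>UNIV. (\<Prod>i\<in>ends e. vec_nth x i) * vec_nth y e)"
    unfolding P by (simp add: sum_distrib_left power3_eq_cube power2_eq_square mult_ac)
  have N: "(norm (c *\<^sub>R w))\<^sup>2 = c\<^sup>2 * (norm w)\<^sup>2" for w :: "'w::real_normed_vector"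
    by (simp add: power_mult_distrib)
  have "icosahedron_cubic (c *\<^sub>R v) = (c * t) ^ 3 - 3 * (c * t) * (c\<^sup>2 * (norm x)\<^sup>2 + c\<^sup>2 * (norm y)\<^sup>2)
      + 9 * (c ^ 3 * (\<Sum>e\<in>UNIV. (\<Prod>i\<in>ends e. vec_nth x i) * vec_nth y e))"
    unfolding v icosahedron_cubic_def S[symmetric] N[symmetric] by simp
  then show "icosahedron_cubic (c *\<^sub>R v) = c ^ 3 * icosahedron_cubic v"
    unfolding v icosahedron_cubic_def
    by (simp add: power_mult_distrib power3_eq_cube power2_eq_square algebra_simps)
qed

lemma hyperbolic_icosahedron_cubic: "hyperbolic icosahedron_cubic e0"
  unfolding hyperbolic_def
proof (intro conjI allI)
  show "\<exists>d. homogeneous_form d icosahedron_cubic" using homogeneous_icosahedron_cubic by blast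
  show "icosahedron_cubic e0 > 0" by (simp add: icosahedron_cubic_def e0_def)
  fix v :: icosahedron_space
  obtain x0 x y where v: "v = (x0, x, y)" by (cases v) auto
  define n where "n = (norm x)\<^sup>2 + (norm y)\<^sup>2"
  define s where "s = (\<Sum>e\<in>UNIV. (\<Prod>i\<in>ends e. vec_nth x i) * vec_nth y e)"
  define q where "q = [:x0 ^ 3 - 3 * n * x0 + 9 * s, 3 * x0\<^sup>2 - 3 * n, 3 * x0, 1:]"
  have "poly q t = icosahedron_cubic (v + t *\<^sub>R e0)" for t
    unfolding q_def v e0_def icosahedron_cubic_def
    by (simp add: n_def s_def power3_eq_cube power2_eq_square algebra_simps)
  moreover have "z \<in> \<real>" if z: "poly (map_poly complex_of_real q) z = 0" for z
  proof -
    have "(z + of_real x0) ^ 3 - 3 * of_real n * (z + of_real x0) + 2 * of_real (9 / 2 * s) = 0"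
      using z unfolding q_def
      by (simp add: map_poly_pCons power3_eq_cube power2_eq_square algebra_simps)
    moreover have "n \<ge> 0" by (simp add: n_def)
    moreover have "(9 / 2 * s)\<^sup>2 \<le> n ^ 3" unfolding s_def n_def by (rule cubic_bound)
    ultimately have "z + of_real x0 \<in> \<real>" by (intro cubic_real_rooted)
    then show ?thesis by (metis Reals_diff Reals_of_real add_diff_cancel_right')
  qed
  ultimately show "\<exists>q :: real poly. (\<forall>t. poly q t = icosahedron_cubic (v + t *\<^sub>R e0)) \<and>
      (\<forall>z :: complex. poly (map_poly complex_of_real q) z = 0 \<longrightarrow> z \<in> \<real>)" by blast
qed

section \<open>Infeasibility of the Gram conditions\<close>

text \<open>Real matrices and other finite families are functions on an index set \<open>P\<close>, and \<open>ip P\<close> is their entrywise inner product.\<close>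

definition ip :: "'p set \<Rightarrow> ('p \<Rightarrow> real) \<Rightarrow> ('p \<Rightarrow> real) \<Rightarrow> real" where
  "ip P f h = (\<Sum>p\<in>P. f p * h p)"

text \<open>The polarized relations described at the beginning, with \<open>u a\<close> and \<open>c a b\<close> indexed by cells. An edge may be given
by its end points in either order.\<close>

locale icosahedral_gram =
  fixes P :: "'p set" and u :: "nat \<times> nat \<Rightarrow> 'p \<Rightarrow> real" and c :: "nat \<times> nat \<Rightarrow> nat \<times> nat \<Rightarrow> 'p \<Rightarrow> real"
  assumes u_sym: "u (i, j) = u (j, i)"
    and c_sym: "c a b = c b a"
    and c_sym1: "c (i, j) b = c (j, i) b"
    and u_norm: "a \<in> set cells \<Longrightarrow> ip P (u a) (u a) = 1"
    and c_diag: "a \<in> set cells \<Longrightarrow> ip P (c a a) (c a a) = 1"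
    and c_pair: "a \<in> set cells \<Longrightarrow> b \<in> set cells \<Longrightarrow> a \<noteq> b \<Longrightarrow>
       ip P (c a a) (c b b) = 1 - 2 * ip P (c a b) (c a b)"
    and c_tri: "i < 12 \<Longrightarrow> j < 12 \<Longrightarrow> k < 12 \<Longrightarrow> ico_adj i j \<Longrightarrow> ico_adj j k \<Longrightarrow> ico_adj i k \<Longrightarrow>
       ip P (c (j, j) (i, j)) (c (k, k) (i, k)) + ip P (c (j, j) (i, k)) (c (k, k) (i, j))
       + ip P (c (j, j) (k, k)) (c (i, j) (i, k)) = 0"
    and uc_vertex: "i < 12 \<Longrightarrow> j < 12 \<Longrightarrow> ico_adj i j \<Longrightarrow> ip P (u (i, i)) (c (j, j) (i, j)) = 3 / 4"
    and uc_edge: "i < 12 \<Longrightarrow> j < 12 \<Longrightarrow> ico_adj i j \<Longrightarrow> ip P (u (i, j)) (c (i, i) (j, j)) = 3 / 4"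
    and uc_tri: "i < 12 \<Longrightarrow> j < 12 \<Longrightarrow> k < 12 \<Longrightarrow> ico_adj i j \<Longrightarrow> ico_adj j k \<Longrightarrow> ico_adj i k \<Longrightarrow>
       ip P (u (j, k)) (c (i, j) (i, k)) = 0"
begin

lemma c_sym2: "c a (i, j) = c a (j, i)"
  using c_sym c_sym1 by metis

definition sqlen :: "nat \<times> nat \<Rightarrow> nat \<times> nat \<Rightarrow> real" where
  "sqlen a b = ip P (c a b) (c a b)"

lemma sqlen_nonneg: "sqlen a b \<ge> 0"
  unfolding sqlen_def ip_def by (intro sum_nonneg) simp

lemma vertex_cell: "i < 12 \<Longrightarrow> (i, i) \<in> set cells"
  by (auto simp: cells_def)

lemma edge_cell:
  assumes "i < 12" "j < 12" "ico_adj i j"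
  shows "(i, j) \<in> set cells \<or> (j, i) \<in> set cells"
  using assms ico_adj_irrefl[of i] ico_adj_sym[of i j] by (cases i j rule: linorder_cases) (auto simp: cells_def)

lemma u_edge_norm: "i < 12 \<Longrightarrow> j < 12 \<Longrightarrow> ico_adj i j \<Longrightarrow> ip P (u (i, j)) (u (i, j)) = 1"
  using edge_cell u_norm u_sym by metis

lemma threshold_diag: "a \<in> set cells \<Longrightarrow> threshold a a = 0"
  by (auto simp: cells_def threshold_def ico_adj_irrefl ico_adj_sym)

text \<open>The upper bound: positive semidefiniteness of \<^const>\<open>moment\<close>, applied to the vectors \<open>c a a\<close>. The total of all
entries is \<open>10334682\<close>.\<close>

lemma moment_bound:
  "2 * (\<Sum>a\<leftarrow>cells. \<Sum>b\<leftarrow>cells. of_int (threshold a b) * sqlen a b) \<le> 10334682"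
proof -
  have "0 \<le> (\<Sum>p\<in>P. \<Sum>a\<leftarrow>cells. \<Sum>b\<leftarrow>cells. of_int (moment a b) * (c a a p * c b b p))"
    unfolding moment_form by (intro sum_nonneg sum_list_nonneg) auto
  also have "\<dots> = (\<Sum>a\<leftarrow>cells. \<Sum>b\<leftarrow>cells. of_int (moment a b) * ip P (c a a) (c b b))"
  proof -
    have swap: "(\<Sum>p\<in>P. \<Sum>a\<leftarrow>xs. f p a) = (\<Sum>a\<leftarrow>xs. \<Sum>p\<in>P. f p a)" for f :: "'p \<Rightarrow> nat \<times> nat \<Rightarrow> real" and xs
      by (induction xs) (simp_all add: sum.distrib)
    show ?thesis unfolding swap ip_def by (simp add: sum_distrib_left)
  qed
  also have "\<dots> \<le> (\<Sum>a\<leftarrow>cells. \<Sum>b\<leftarrow>cells. of_int (moment a b) - 2 * (of_int (threshold a b) * sqlen a b))"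
  proof (intro sum_list_mono)
    fix a b assume ab: "a \<in> set cells" "b \<in> set cells"
    show "of_int (moment a b) * ip P (c a a) (c b b) \<le> of_int (moment a b) - 2 * (of_int (threshold a b) * sqlen a b)"
    proof (cases "a = b")
      case True
      then show ?thesis using c_diag[OF ab(1)] threshold_diag[OF ab(1)] by simp
    next
      case False
      have "of_int (threshold a b) * sqlen a b \<le> of_int (moment a b) * sqlen a b"
        using threshold_le_moment[OF ab] sqlen_nonneg by (intro mult_right_mono) auto
      then show ?thesis unfolding c_pair[OF ab False] sqlen_def[symmetric] by (simp add: algebra_simps)
    qed
  qed
  also have "\<dots> = 10334682 - 2 * (\<Sum>a\<leftarrow>cells. \<Sum>b\<leftarrow>cells. of_int (threshold a b) * sqlen a b)"
    using moment_total by (simp add: sum_list_subtractf sum_list_const_mult)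
  finally show ?thesis by simp
qed

lemma sqlen_sym: "sqlen a b = sqlen b a" and sqlen_sym1: "sqlen (i, j) b = sqlen (j, i) b"
  unfolding sqlen_def by (simp_all only: c_sym[of a b] c_sym1[of i j])

lemma sqlen_sym2: "sqlen b (i, j) = sqlen b (j, i)"
  using sqlen_sym sqlen_sym1 by metis

lemma threshold_sym1: "threshold (i, j) b = threshold (j, i) b"
  by (cases b) (auto simp: threshold_def)

lemma threshold_sym2: "threshold b (i, j) = threshold b (j, i)"
  by (cases b) (auto simp: threshold_def)

text \<open>Passing from edges to ordered edges. An edge has two orderings, and a pair of edges of a common triangle is
determined by the common vertex and the ordered pair of the other two.\<close>

lemma threshold_sum:
  "(\<Sum>a\<leftarrow>cells. \<Sum>b\<leftarrow>cells. of_int (threshold a b) * sqlen a b) =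
     55454 * asum (\<lambda>i j. sqlen (i, i) (j, j)) + 2 * 22912 * asum (\<lambda>i j. sqlen (j, j) (i, j))
     + 12981 * tsum (\<lambda>i j k. sqlen (i, i) (j, k)) + 6106 * tsum (\<lambda>i j k. sqlen (i, j) (i, k))"
proof -
  define h where "h a b = of_int (threshold a b) * sqlen a b" for a b
  have h1: "h (i, j) b = h (j, i) b" and h2: "h b (i, j) = h b (j, i)" for i j b
    unfolding h_def using threshold_sym1 threshold_sym2 sqlen_sym1 sqlen_sym2 by metis+
  have "(\<Sum>a\<leftarrow>cells. \<Sum>b\<leftarrow>cells. h a b) = (\<Sum>a\<leftarrow>cells. (\<Sum>k<12. h a (k, k)) + asum (\<lambda>k l. h a (k, l)) / 2)"
    by (simp add: sum_cells h2)
  also have "\<dots> = (\<Sum>i<12. (\<Sum>k<12. h (i, i) (k, k)) + asum (\<lambda>k l. h (i, i) (k, l)) / 2)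
      + asum (\<lambda>i j. (\<Sum>k<12. h (i, j) (k, k)) + asum (\<lambda>k l. h (i, j) (k, l)) / 2) / 2"
    by (rule sum_cells) (simp add: h1)
  also have "\<dots> = (\<Sum>i<12. \<Sum>k<12. h (i, i) (k, k)) + (\<Sum>i<12. asum (\<lambda>k l. h (i, i) (k, l))) / 2
      + asum (\<lambda>i j. \<Sum>k<12. h (i, j) (k, k)) / 2 + asum (\<lambda>i j. asum (\<lambda>k l. h (i, j) (k, l))) / 4"
    by (simp add: asum_add asum_divide sum.distrib sum_divide_distrib[symmetric] add_divide_distrib)
  also have "(\<Sum>i<12. \<Sum>k<12. h (i, i) (k, k)) = 55454 * asum (\<lambda>i j. sqlen (i, i) (j, j))"
    unfolding asum_def by (simp add: h_def threshold_def adj01_def sum_distrib_left mult_ac)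
  also have VE: "(\<Sum>i<12. asum (\<lambda>k l. h (i, i) (k, l))) =
     2 * 22912 * asum (\<lambda>i j. sqlen (j, j) (i, j)) + 12981 * tsum (\<lambda>i j k. sqlen (i, i) (j, k))"
  proof -
    have "(\<Sum>i<12. asum (\<lambda>k l. h (i, i) (k, l))) = (\<Sum>i<12. \<Sum>k<12. \<Sum>l<12.
       of_bool (i = k) * (22912 * (adj01 k l * sqlen (i, i) (k, l))) + of_bool (i = l) * (22912 * (adj01 k l * sqlen (i, i) (k, l)))
       + 12981 * (tri i k l * sqlen (i, i) (k, l)))"
      unfolding asum_def
    proof (intro sum.cong refl)
      fix i k l
      show "adj01 k l * h (i, i) (k, l) = of_bool (i = k) * (22912 * (adj01 k l * sqlen (i, i) (k, l)))
          + of_bool (i = l) * (22912 * (adj01 k l * sqlen (i, i) (k, l))) + 12981 * (tri i k l * sqlen (i, i) (k, l))"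
      proof (cases "ico_adj k l")
        case True
        then have "k \<noteq> l" using ico_adj_irrefl by blast
        then have "of_bool (i = k \<or> i = l) = (of_bool (i = k) + of_bool (i = l) :: real)" by auto
        then have "real_of_int (threshold (i, i) (k, l)) = (of_bool (i = k) + of_bool (i = l)) * 22912 + tri i k l * 12981"
          using \<open>k \<noteq> l\<close> True by (simp add: threshold_def tri_def conj_commute)
        moreover have "adj01 k l = 1" using True by (simp add: adj01_def)
        ultimately show ?thesis unfolding h_def by (simp only:) (simp add: algebra_simps)
      qed (auto simp: adj01_def tri_def)
    qed
    also have "\<dots> = (\<Sum>k<12. \<Sum>l<12. \<Sum>i<12. of_bool (i = k) * (22912 * (adj01 k l * sqlen (i, i) (k, l))))
       + (\<Sum>k<12. \<Sum>l<12. \<Sum>i<12. of_bool (i = l) * (22912 * (adj01 k l * sqlen (i, i) (k, l))))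
       + 12981 * tsum (\<lambda>i j k. sqlen (i, i) (j, k))"
    proof -
      have sw: "(\<Sum>i<12. \<Sum>k<12. \<Sum>l<12. f i k l) = (\<Sum>k<12. \<Sum>l<12. \<Sum>i<12. f i k l)" for f :: "nat \<Rightarrow> nat \<Rightarrow> nat \<Rightarrow> real"
        by (subst sum.swap) (intro sum.cong refl sum.swap)
      show ?thesis unfolding sum.distrib tsum_def sum_distrib_left 
        by (simp only: sw[of "\<lambda>i k l. of_bool (i = k) * (22912 * (adj01 k l * sqlen (i, i) (k, l)))"]
          sw[of "\<lambda>i k l. of_bool (i = l) * (22912 * (adj01 k l * sqlen (i, i) (k, l)))"])
    qed
    also have "\<dots> = 22912 * asum (\<lambda>k l. sqlen (k, k) (k, l)) + 22912 * asum (\<lambda>k l. sqlen (l, l) (k, l))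
       + 12981 * tsum (\<lambda>i j k. sqlen (i, i) (j, k))"
      by (simp add: delta_sum asum_def sum_distrib_left)
    also have "asum (\<lambda>k l. sqlen (k, k) (k, l)) = asum (\<lambda>k l. sqlen (l, l) (k, l))"
      by (subst asum_swap) (simp only: sqlen_sym2[of _ _ _])
    finally show ?thesis by simp
  qed
  also have "asum (\<lambda>i j. \<Sum>k<12. h (i, j) (k, k)) = (\<Sum>k<12. asum (\<lambda>i j. h (k, k) (i, j)))"
  proof -
    have hs: "h (i, j) (k, k) = h (k, k) (i, j)" if "ico_adj i j" for i j k
      using that unfolding h_def by (auto simp: threshold_def ico_adj_irrefl sqlen_sym[of "(i,j)"])
    have "asum (\<lambda>i j. \<Sum>k<12. h (i, j) (k, k)) = (\<Sum>i<12. \<Sum>j<12. \<Sum>k<12. adj01 i j * h (k, k) (i, j))"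
      unfolding asum_def sum_distrib_left 
    proof (intro sum.cong refl)
      fix i j k
      show "adj01 i j * h (i, j) (k, k) = adj01 i j * h (k, k) (i, j)"
        by (cases "ico_adj i j") (simp_all add: adj01_def hs[of i j k])
    qed
    also have "\<dots> = (\<Sum>k<12. \<Sum>i<12. \<Sum>j<12. adj01 i j * h (k, k) (i, j))"
    proof -
      have sw: "(\<Sum>i<12. \<Sum>k<12. \<Sum>l<12. f i k l) = (\<Sum>k<12. \<Sum>l<12. \<Sum>i<12. f i k l)" for f :: "nat \<Rightarrow> nat \<Rightarrow> nat \<Rightarrow> real"
        by (subst sum.swap) (intro sum.cong refl sum.swap)
      show ?thesis by (rule sw[symmetric])
    qed
    finally show ?thesis unfolding asum_def .
  qed
  also note VE
  also have "asum (\<lambda>i j. asum (\<lambda>k l. h (i, j) (k, l))) = 4 * (6106 * tsum (\<lambda>i j k. sqlen (i, j) (i, k)))"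
  proof -
    let ?w = "\<lambda>i j k l. 6106 * (adj01 i j * adj01 k l * sqlen (i, j) (k, l))"
    have "asum (\<lambda>i j. asum (\<lambda>k l. h (i, j) (k, l))) = (\<Sum>i<12. \<Sum>j<12. \<Sum>k<12. \<Sum>l<12.
        of_bool (i = k) * (adj01 j l * ?w i j k l) + of_bool (i = l) * (adj01 j k * ?w i j k l)
        + of_bool (j = k) * (adj01 i l * ?w i j k l) + of_bool (j = l) * (adj01 i k * ?w i j k l))"
      unfolding asum_def sum_distrib_left
    proof (intro sum.cong refl)
      fix i j k l
      show "adj01 i j * (adj01 k l * h (i, j) (k, l)) =
        of_bool (i = k) * (adj01 j l * ?w i j k l) + of_bool (i = l) * (adj01 j k * ?w i j k l)
        + of_bool (j = k) * (adj01 i l * ?w i j k l) + of_bool (j = l) * (adj01 i k * ?w i j k l)"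
      proof (cases "ico_adj i j \<and> ico_adj k l")
        case True
        then have "i \<noteq> j" "k \<noteq> l" using ico_adj_irrefl by blast+
        then have "real_of_int (threshold (i, j) (k, l)) = (of_bool (i = k) * adj01 j l + of_bool (i = l) * adj01 j k
            + of_bool (j = k) * adj01 i l + of_bool (j = l) * adj01 i k) * 6106"
          by (simp add: threshold_def of_bool_conj adj01_def)
        moreover have "adj01 i j = 1" "adj01 k l = 1" using True by (simp_all add: adj01_def)
        ultimately show ?thesis unfolding h_def by (simp only:) (simp add: algebra_simps)
      qed (auto simp: adj01_def)
    qed
    also have "\<dots> = (\<Sum>i<12. \<Sum>j<12. \<Sum>l<12. \<Sum>k<12. of_bool (i = k) * (adj01 j l * ?w i j k l))
        + (\<Sum>i<12. \<Sum>j<12. \<Sum>k<12. \<Sum>l<12. of_bool (i = l) * (adj01 j k * ?w i j k l))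
        + (\<Sum>i<12. \<Sum>j<12. \<Sum>l<12. \<Sum>k<12. of_bool (j = k) * (adj01 i l * ?w i j k l))
        + (\<Sum>i<12. \<Sum>j<12. \<Sum>k<12. \<Sum>l<12. of_bool (j = l) * (adj01 i k * ?w i j k l))"
    proof -
      have sw: "(\<Sum>i<12. \<Sum>j<12. \<Sum>k<12. \<Sum>l<12. f i j k l) = (\<Sum>i<12. \<Sum>j<12. \<Sum>l<12. \<Sum>k<12. f i j k l)"
        for f :: "nat \<Rightarrow> nat \<Rightarrow> nat \<Rightarrow> nat \<Rightarrow> real"
        by (intro sum.cong refl sum.swap)
      show ?thesis unfolding sum.distrib
        by (simp only: sw[of "\<lambda>i j k l. of_bool (i = k) * (adj01 j l * ?w i j k l)"]
             sw[of "\<lambda>i j k l. of_bool (j = k) * (adj01 i l * ?w i j k l)"])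
    qed
    also have "\<dots> = (\<Sum>i<12. \<Sum>j<12. \<Sum>l<12. 6106 * (tri i j l * sqlen (i, j) (i, l)))
        + (\<Sum>i<12. \<Sum>j<12. \<Sum>k<12. 6106 * (tri i j k * sqlen (i, j) (k, i)))
        + (\<Sum>i<12. \<Sum>j<12. \<Sum>l<12. 6106 * (tri i j l * sqlen (i, j) (j, l)))
        + (\<Sum>i<12. \<Sum>j<12. \<Sum>k<12. 6106 * (tri i j k * sqlen (i, j) (k, j)))"
      by (intro arg_cong2[where f = "(+)"] sum.cong refl; simp only: delta_sum lessThan_iff; simp add: tri_adj01 adj01_sym mult_ac)
    also have "\<dots> = 6106 * (tsum (\<lambda>i j k. sqlen (i, j) (i, k)) + tsum (\<lambda>i j k. sqlen (i, j) (k, i))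
        + tsum (\<lambda>i j k. sqlen (i, j) (j, k)) + tsum (\<lambda>i j k. sqlen (i, j) (k, j)))"
      by (simp add: tsum_def sum_distrib_left)
    also have "tsum (\<lambda>i j k. sqlen (i, j) (k, i)) = tsum (\<lambda>i j k. sqlen (i, j) (i, k))"
      by (simp only: sqlen_sym2[of _ _ "_ :: nat"] sqlen_sym2)
    also have "tsum (\<lambda>i j k. sqlen (i, j) (k, j)) = tsum (\<lambda>i j k. sqlen (i, j) (j, k))"
      by (simp only: sqlen_sym2[of _ _ "_ :: nat"] sqlen_sym2)
    also have "tsum (\<lambda>i j k. sqlen (i, j) (j, k)) = tsum (\<lambda>i j k. sqlen (i, j) (i, k))"
      by (subst tsum_swap12) (simp only: sqlen_sym1)
    finally show ?thesis by simp
  qed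
  finally show ?thesis unfolding h_def by simp
qed

text \<open>The sum of the vectors \<open>c (j, j) (i, j)\<close> over the five neighbours \<open>j\<close> of \<open>i\<close> has inner product \<open>5 * 3 / 4\<close> with the
unit vector \<open>u i\<close>, hence norm at least \<open>15 / 4\<close>.\<close>

lemma star_bound:
  assumes i: "i < 12"
  shows "(48874 / 5) * (225 / 16) \<le> 22912 * (\<Sum>j<12. adj01 i j * sqlen (j, j) (i, j))
     + 12981 * (\<Sum>j<12. \<Sum>k<12. tri i j k * ip P (c (j, j) (i, j)) (c (k, k) (i, k)))"
proof -
  define y where "y j = c (j, j) (i, j)" for j
  define \<alpha> where "\<alpha> = u (i, i)"
  have point: "(48874 / 5) * (15 / 2 * (\<Sum>j<12. adj01 i j * (\<alpha> p * y j p)) - 225 / 16 * (\<alpha> p * \<alpha> p)) \<le>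
     22912 * (\<Sum>j<12. adj01 i j * (y j p * y j p)) + 12981 * (\<Sum>j<12. \<Sum>k<12. tri i j k * (y j p * y k p))" for p
  proof -
    have "15 / 2 * (\<alpha> p * s) - 225 / 16 * (\<alpha> p * \<alpha> p) \<le> s\<^sup>2" for s
      using zero_le_power2[of "s - 15 / 4 * \<alpha> p"] by (simp add: power2_eq_square algebra_simps)
    then have "(48874 / 5) * (15 / 2 * (\<alpha> p * (\<Sum>j<12. adj01 i j * y j p)) - 225 / 16 * (\<alpha> p * \<alpha> p)) \<le>
        (48874 / 5) * (\<Sum>j<12. adj01 i j * y j p)\<^sup>2"
      by (intro mult_left_mono) simp_all
    also note star_form[OF i, of "\<lambda>j. y j p"]
    also have "\<alpha> p * (\<Sum>j<12. adj01 i j * y j p) = (\<Sum>j<12. adj01 i j * (\<alpha> p * y j p))"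
      by (simp add: sum_distrib_left mult_ac)
    finally show ?thesis by (simp only: power2_eq_square)
  qed
  have swap1: "(\<Sum>p\<in>P. \<Sum>j<12. adj01 i j * f j p) = (\<Sum>j<12. adj01 i j * (\<Sum>p\<in>P. f j p))" for f :: "nat \<Rightarrow> 'p \<Rightarrow> real"
    unfolding sum_distrib_left by (rule sum.swap)
  have swap2: "(\<Sum>p\<in>P. \<Sum>j<12. \<Sum>k<12. tri i j k * f j k p) = (\<Sum>j<12. \<Sum>k<12. tri i j k * (\<Sum>p\<in>P. f j k p))"
    for f :: "nat \<Rightarrow> nat \<Rightarrow> 'p \<Rightarrow> real"
    unfolding sum_distrib_left by (subst sum.swap) (intro sum.cong refl sum.swap)
  have "(\<Sum>p\<in>P. (48874 / 5) * (15 / 2 * (\<Sum>j<12. adj01 i j * (\<alpha> p * y j p)) - 225 / 16 * (\<alpha> p * \<alpha> p))) \<le>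
     (\<Sum>p\<in>P. 22912 * (\<Sum>j<12. adj01 i j * (y j p * y j p)) + 12981 * (\<Sum>j<12. \<Sum>k<12. tri i j k * (y j p * y k p)))"
    by (rule sum_mono) (rule point)
  then have "(48874 / 5) * (15 / 2 * (\<Sum>j<12. adj01 i j * ip P \<alpha> (y j)) - 225 / 16 * ip P \<alpha> \<alpha>) \<le>
     22912 * (\<Sum>j<12. adj01 i j * ip P (y j) (y j)) + 12981 * (\<Sum>j<12. \<Sum>k<12. tri i j k * ip P (y j) (y k))"
    unfolding ip_def by (simp only: sum.distrib sum_subtractf sum_distrib_left[symmetric] swap1 swap2)
  moreover have "ip P \<alpha> \<alpha> = 1" unfolding \<alpha>_def by (rule u_norm[OF vertex_cell[OF i]])
  moreover have "(\<Sum>j<12. adj01 i j * ip P \<alpha> (y j)) = (\<Sum>j<12. adj01 i j * (3 / 4))"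
    unfolding \<alpha>_def y_def using i by (intro sum.cong refl) (auto simp: adj01_def uc_vertex)
  moreover have "\<dots> = 15 / 4" by (simp only: sum_distrib_right[symmetric] degree_5[OF i])
  ultimately show ?thesis unfolding y_def sqlen_def by simp
qed

lemma edge_form:
  fixes r d :: real
  shows "0 \<le> 27727 * (r * r) + 2 * 12981 * (r * d) + 6106 * (d * d)"
proof -
  have scale: "0 \<le> t" if "0 \<le> 27727 * t" for t :: real using that by simp
  \<comment> \<open>The remainder is \<open>27727 * 6106 - 12981\<^sup>2 = 794701\<close>.\<close>
  have "27727 * (27727 * (r * r) + 2 * 12981 * (r * d) + 6106 * (d * d)) = (27727 * r + 12981 * d)\<^sup>2 + 794701 * (d * d)"
    by (simp add: power2_eq_square algebra_simps)
  moreover have "0 \<le> (27727 * r + 12981 * d)\<^sup>2 + 794701 * (d * d)" by simp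
  ultimately have "0 \<le> 27727 * (27727 * (r * r) + 2 * 12981 * (r * d) + 6106 * (d * d))" by (simp only:)
  then show ?thesis by (rule scale)
qed

text \<open>The vector \<open>c (j, j) (k, k)\<close> has inner product \<open>3 / 4\<close> with the unit vector \<open>u (j, k)\<close>, which is orthogonal to the vector
\<open>c (i, j) (i, k)\<close>. Splitting off this component leaves a nonnegative form. The coefficient \<open>27727 = 55454 / 2\<close> appears
because the edge \<open>{j, k}\<close> is shared by two triangles.\<close>

lemma edge_bound:
  assumes "i < 12" "j < 12" "k < 12" "ico_adj i j" "ico_adj j k" "ico_adj i k"
  shows "27727 * (9 / 16) \<le> 27727 * sqlen (j, j) (k, k) + 2 * 12981 * ip P (c (j, j) (k, k)) (c (i, j) (i, k)) + 6106 * sqlen (i, j) (i, k)"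
proof -
  define \<alpha> x d where "\<alpha> = u (j, k)" and "x = c (j, j) (k, k)" and "d = c (i, j) (i, k)"
  have "0 \<le> (\<Sum>p\<in>P. 27727 * (x p * x p) - 27727 * 3 / 2 * (\<alpha> p * x p) + 27727 * 9 / 16 * (\<alpha> p * \<alpha> p)
     + 2 * 12981 * (x p * d p) - 3 / 2 * 12981 * (\<alpha> p * d p) + 6106 * (d p * d p))"
  proof (rule sum_nonneg)
    fix p
    show "0 \<le> 27727 * (x p * x p) - 27727 * 3 / 2 * (\<alpha> p * x p) + 27727 * 9 / 16 * (\<alpha> p * \<alpha> p)
     + 2 * 12981 * (x p * d p) - 3 / 2 * 12981 * (\<alpha> p * d p) + 6106 * (d p * d p)"
      using edge_form[of "x p - 3 / 4 * \<alpha> p" "d p"] by (simp add: algebra_simps)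
  qed
  then have "0 \<le> 27727 * ip P x x - 27727 * 3 / 2 * ip P \<alpha> x + 27727 * 9 / 16 * ip P \<alpha> \<alpha>
     + 2 * 12981 * ip P x d - 3 / 2 * 12981 * ip P \<alpha> d + 6106 * ip P d d"
    unfolding ip_def by (simp only: sum.distrib sum_subtractf sum_distrib_left[symmetric])
  moreover have "ip P \<alpha> x = 3 / 4" "ip P \<alpha> d = 0" "ip P \<alpha> \<alpha> = 1"
    unfolding \<alpha>_def x_def d_def using assms uc_edge uc_tri u_edge_norm by auto
  ultimately show ?thesis unfolding sqlen_def x_def[symmetric] d_def[symmetric] by simp
qed

lemma tsum_last: "tsum (\<lambda>i j k. f j k) = 2 * asum f"
  by (subst tsum_swap12, subst tsum_swap23) (rule tsum_asum)

text \<open>The relation \<open>c_tri\<close>, summed over all triangles, turns the star products \<open>S\<close> into \<open>- X - Z\<close>; \<open>X\<close> is controlled by the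
vertex-edge pairs of each triangle and \<open>Z\<close> by the edges.\<close>

theorem gram_contradiction: False
proof -
  define E Y W V X Z S where
    "E = asum (\<lambda>i j. sqlen (i, i) (j, j))" and
    "Y = asum (\<lambda>i j. sqlen (j, j) (i, j))" and
    "W = tsum (\<lambda>i j k. sqlen (i, i) (j, k))" and
    "V = tsum (\<lambda>i j k. sqlen (i, j) (i, k))" and
    "X = tsum (\<lambda>i j k. ip P (c (j, j) (i, k)) (c (k, k) (i, j)))" and
    "Z = tsum (\<lambda>i j k. ip P (c (j, j) (k, k)) (c (i, j) (i, k)))" and
    "S = tsum (\<lambda>i j k. ip P (c (j, j) (i, j)) (c (k, k) (i, k)))"
  have total: "2 * (55454 * E + 2 * 22912 * Y + 12981 * W + 6106 * V) \<le> 10334682"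
    using moment_bound unfolding threshold_sum E_def Y_def W_def V_def .
  have "(\<Sum>i<12::nat. (48874 / 5) * (225 / 16)) \<le> (\<Sum>i<12. 22912 * (\<Sum>j<12. adj01 i j * sqlen (j, j) (i, j))
     + 12981 * (\<Sum>j<12. \<Sum>k<12. tri i j k * ip P (c (j, j) (i, j)) (c (k, k) (i, k))))"
    using star_bound by (intro sum_mono) simp
  then have star: "12 * ((48874 / 5) * (225 / 16)) \<le> 22912 * Y + 12981 * S"
    unfolding Y_def S_def asum_def tsum_def by (simp add: sum.distrib sum_distrib_left)
  have "tsum (\<lambda>i j k. ip P (c (j, j) (i, j)) (c (k, k) (i, k)) + ip P (c (j, j) (i, k)) (c (k, k) (i, j))
       + ip P (c (j, j) (k, k)) (c (i, j) (i, k))) = tsum (\<lambda>i j k. 0)"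
    using c_tri by (intro antisym tsum_mono) simp_all
  then have tri0: "S + X + Z = 0"
    unfolding tsum_add S_def X_def Z_def by (simp add: tsum_def)
  have "tsum (\<lambda>i j k. 0) \<le> tsum (\<lambda>i j k. (sqlen (i, i) (j, k) + sqlen (j, j) (i, k) + sqlen (k, k) (i, j))
     + 2 * (ip P (c (i, i) (j, k)) (c (j, j) (i, k)) + ip P (c (i, i) (j, k)) (c (k, k) (i, j)) + ip P (c (j, j) (i, k)) (c (k, k) (i, j))))"
  proof (rule tsum_mono)
    fix i j k
    have "0 \<le> (\<Sum>p\<in>P. (c (i, i) (j, k) p + c (j, j) (i, k) p + c (k, k) (i, j) p)\<^sup>2)"
      by (intro sum_nonneg) simp
    then show "0 \<le> (sqlen (i, i) (j, k) + sqlen (j, j) (i, k) + sqlen (k, k) (i, j))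
     + 2 * (ip P (c (i, i) (j, k)) (c (j, j) (i, k)) + ip P (c (i, i) (j, k)) (c (k, k) (i, j)) + ip P (c (j, j) (i, k)) (c (k, k) (i, j)))"
      unfolding sqlen_def ip_def by (simp add: power2_eq_square algebra_simps sum.distrib sum_distrib_left)
  qed
  also have "\<dots> = (W + W + W) + 2 * (X + X + X)"
  proof -
    have "tsum (\<lambda>i j k. sqlen (j, j) (i, k)) = W"
      unfolding W_def by (subst tsum_swap12) (rule refl)
    moreover have "tsum (\<lambda>i j k. sqlen (k, k) (i, j)) = W"
      unfolding W_def by (subst tsum_swap23, subst tsum_swap12) (rule refl)
    moreover have x2: "tsum (\<lambda>i j k. ip P (c (i, i) (j, k)) (c (k, k) (i, j))) = X"
      unfolding X_def by (subst tsum_swap12) (simp only: c_sym2)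
    moreover have "tsum (\<lambda>i j k. ip P (c (i, i) (j, k)) (c (j, j) (i, k))) = X"
      unfolding x2[symmetric] by (subst tsum_swap23) (simp only: c_sym2)
    ultimately show ?thesis
      unfolding tsum_add tsum_cmult by (simp only: W_def[symmetric] X_def[symmetric])
  qed
  finally have tri1: "0 \<le> W + 2 * X" by (simp add: tsum_def)
  have "tsum (\<lambda>i j k. 27727 * (9 / 16) * 1) \<le> tsum (\<lambda>i j k. 27727 * sqlen (j, j) (k, k)
      + 2 * 12981 * ip P (c (j, j) (k, k)) (c (i, j) (i, k)) + 6106 * sqlen (i, j) (i, k))"
    using edge_bound by (intro tsum_mono) simp
  moreover have "tsum (\<lambda>i j k. 1) = 120"
    using tsum_asum[of "\<lambda>_ _. 1"] asum_1 by simp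
  moreover have "tsum (\<lambda>i j k. sqlen (j, j) (k, k)) = 2 * E"
    unfolding E_def by (rule tsum_last)
  ultimately have "27727 * (9 / 16) * 120 \<le> 27727 * (2 * E) + 2 * 12981 * Z + 6106 * V"
    unfolding tsum_add tsum_cmult Z_def V_def by simp
  then have "1871572 \<le> 55454 * E + 25962 * Z + 6106 * V" by simp
  moreover have "3298994 \<le> 45824 * Y + 25962 * S" using star by simp
  moreover have "55454 * E + 45824 * Y + 12981 * W + 6106 * V \<le> 5167341" using total by simp
  \<comment> \<open>\<open>S + Z = - X\<close> by \<open>tri0\<close>, and \<open>12981 * W + 25962 * X \<ge> 0\<close> by \<open>tri1\<close>; the two lower bounds add up to \<open>5170566 > 5167341\<close>.\<close>
  ultimately show False using tri0 tri1 by linarith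
qed

end

section \<open>Traces of a determinantal representation\<close>

lemma mat_mult_entry:
  assumes "A \<in> carrier_mat n m" "B \<in> carrier_mat m p" "i < n" "j < p"
  shows "(A * B) $$ (i, j) = (\<Sum>k<m. A $$ (i, k) * B $$ (k, j))"
  using assms by (auto simp: scalar_prod_def lessThan_atLeast0)

text \<open>The trace of an \<open>n \<times> n\<close> matrix.\<close>

definition mtrace :: "nat \<Rightarrow> 'a::comm_ring_1 mat \<Rightarrow> 'a" where
  "mtrace n A = (\<Sum>i<n. A $$ (i, i))"

lemma mtrace_comm:
  assumes A: "A \<in> carrier_mat n n" and B: "B \<in> carrier_mat n n"
  shows "mtrace n (A * B) = mtrace n (B * A)"
proof -
  have "mtrace n (A * B) = (\<Sum>i<n. \<Sum>k<n. A $$ (i, k) * B $$ (k, i))"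
    unfolding mtrace_def by (intro sum.cong refl) (simp add: mat_mult_entry[OF A B])
  also have "\<dots> = (\<Sum>k<n. \<Sum>i<n. B $$ (k, i) * A $$ (i, k))"
    by (subst sum.swap) (simp add: mult.commute)
  also have "\<dots> = mtrace n (B * A)"
    unfolding mtrace_def by (intro sum.cong refl) (simp add: mat_mult_entry[OF B A])
  finally show ?thesis .
qed

lemma mtrace_similar:
  assumes A: "A \<in> carrier_mat n n" and sim: "similar_mat_wit A B P Q"
  shows "mtrace n A = mtrace n B"
proof -
  from similar_mat_witD2[OF A sim] have eq: "A = P * B * Q" "Q * P = 1\<^sub>m n"
    and c: "B \<in> carrier_mat n n" "P \<in> carrier_mat n n" "Q \<in> carrier_mat n n" by auto
  have "mtrace n A = mtrace n (Q * (P * B))"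
    unfolding eq(1) by (rule mtrace_comm) (use c in auto)
  also have "Q * (P * B) = (Q * P) * B" using c by (intro assoc_mult_mat[symmetric]) auto
  also have "\<dots> = B" unfolding eq(2) using c by simp
  finally show ?thesis .
qed

lemma upper_triangular_pow_entries:
  assumes B: "B \<in> carrier_mat n n" and ut: "upper_triangular B" and i: "i < n"
  shows "j < i \<Longrightarrow> (B ^\<^sub>m k) $$ (i, j) = 0" and "(B ^\<^sub>m k) $$ (i, i) = (B $$ (i, i)) ^ k"
proof -
  have "(\<forall>i<n. \<forall>j<i. (B ^\<^sub>m k) $$ (i, j) = 0) \<and> (\<forall>i<n. (B ^\<^sub>m k) $$ (i, i) = (B $$ (i, i)) ^ k)"
  proof (induction k)
    case 0
    then show ?case using B by auto
  next
    case (Suc k)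
    have Bk: "B ^\<^sub>m k \<in> carrier_mat n n" using B by simp
    have low: "B $$ (l, j) = 0" if "j < l" "l < n" for l j using ut B that by auto
    have zero: "(B ^\<^sub>m k) $$ (i, l) * B $$ (l, j) = 0" if "i < n" "l < n" "j < l \<or> l < i" for i l j
      using that Suc.IH low by auto
    have "(B ^\<^sub>m Suc k) $$ (i, j) = 0" if "i < n" "j < i" for i j
    proof -
      have "(B ^\<^sub>m Suc k) $$ (i, j) = (\<Sum>l<n. (B ^\<^sub>m k) $$ (i, l) * B $$ (l, j))"
        using that by (simp add: mat_mult_entry[OF Bk B])
      also have "\<dots> = 0" using that by (intro sum.neutral ballI zero) auto
      finally show ?thesis .
    qed
    moreover have "(B ^\<^sub>m Suc k) $$ (i, i) = (B $$ (i, i)) ^ Suc k" if "i < n" for i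
    proof -
      have "(B ^\<^sub>m Suc k) $$ (i, i) = (\<Sum>l<n. (B ^\<^sub>m k) $$ (i, l) * B $$ (l, i))"
        using that by (simp add: mat_mult_entry[OF Bk B])
      also have "\<dots> = (\<Sum>l\<in>{i}. (B ^\<^sub>m k) $$ (i, l) * B $$ (l, i))"
        using that by (intro sum.mono_neutral_right ballI zero) auto
      finally show ?thesis using Suc.IH that by (simp add: power_commutes)
    qed
    ultimately show ?case by blast
  qed
  then show "j < i \<Longrightarrow> (B ^\<^sub>m k) $$ (i, j) = 0" "(B ^\<^sub>m k) $$ (i, i) = (B $$ (i, i)) ^ k"
    using i by auto
qed

lemma mtrace_pow:
  fixes A :: "complex mat"
  assumes A: "A \<in> carrier_mat n n" and es: "char_poly A = (\<Prod>e\<leftarrow>es. [:- e, 1:])"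
  shows "mtrace n (A ^\<^sub>m k) = (\<Sum>e\<leftarrow>es. e ^ k)"
proof -
  obtain B P Q where dec: "schur_decomposition A es = (B, P, Q)" by (cases "schur_decomposition A es")
  from schur_decomposition[OF A es dec] have sim: "similar_mat_wit A B P Q"
    and ut: "upper_triangular B" and diag: "diag_mat B = es" by auto
  have B: "B \<in> carrier_mat n n" using similar_mat_witD2[OF A sim] by auto
  have "mtrace n (A ^\<^sub>m k) = mtrace n (B ^\<^sub>m k)"
    by (rule mtrace_similar[OF _ similar_mat_wit_pow[OF sim]]) (use A in simp)
  also have "\<dots> = (\<Sum>i<n. (B $$ (i, i)) ^ k)"
    unfolding mtrace_def by (intro sum.cong refl upper_triangular_pow_entries(2)[OF B ut]) simp
  also have "\<dots> = (\<Sum>e\<leftarrow>es. e ^ k)"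
    using B unfolding diag[symmetric] diag_mat_def
    by (simp add: o_def interv_sum_list_conv_sum_set_nat atLeast0LessThan)
  finally show ?thesis .
qed

lemma coeffs_prod_linear:
  fixes as :: "'a::comm_ring_1 list"
  defines "p \<equiv> (\<Prod>a\<leftarrow>as. [:1, - a:])"
  shows "coeff p 0 = 1" "coeff p 1 = - sum_list as" "2 * coeff p 2 = (sum_list as)\<^sup>2 - (\<Sum>a\<leftarrow>as. a\<^sup>2)"
proof -
  have "coeff (\<Prod>a\<leftarrow>as. [:1, - a:]) 0 = 1 \<and> coeff (\<Prod>a\<leftarrow>as. [:1, - a:]) 1 = - sum_list as \<and>
     2 * coeff (\<Prod>a\<leftarrow>as. [:1, - a:]) 2 = (sum_list as)\<^sup>2 - (\<Sum>a\<leftarrow>as. a\<^sup>2)"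
  proof (induction as)
    case (Cons x as)
    let ?p = "\<Prod>a\<leftarrow>as. [:1, - a:]"
    have c0: "coeff ([:1, - x:] * ?p) 0 = coeff ?p 0"
      and cS: "coeff ([:1, - x:] * ?p) (Suc m) = coeff ?p (Suc m) - x * coeff ?p m" for m
      by simp_all
    show ?case using Cons
      by (simp add: c0 cS numeral_2_eq_2 algebra_simps power2_eq_square del: mult_pCons_left)
  qed simp
  then show "coeff p 0 = 1" "coeff p 1 = - sum_list as" "2 * coeff p 2 = (sum_list as)\<^sup>2 - (\<Sum>a\<leftarrow>as. a\<^sup>2)"
    unfolding p_def by auto
qed

lemma coeffs_cubic_power:
  fixes a b :: "'a::comm_ring_1"
  shows "coeff ([:1, 0, - a, - b:] ^ l) 0 = 1" "coeff ([:1, 0, - a, - b:] ^ l) 1 = 0"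
    "coeff ([:1, 0, - a, - b:] ^ l) 2 = - of_nat l * a"
proof -
  have "coeff ([:1, 0, - a, - b:] ^ l) 0 = 1 \<and> coeff ([:1, 0, - a, - b:] ^ l) 1 = 0 \<and>
    coeff ([:1, 0, - a, - b:] ^ l) 2 = - of_nat l * a"
    by (induction l) (simp_all add: coeff_mult numeral_2_eq_2 algebra_simps)
  then show "coeff ([:1, 0, - a, - b:] ^ l) 0 = 1" "coeff ([:1, 0, - a, - b:] ^ l) 1 = 0"
    "coeff ([:1, 0, - a, - b:] ^ l) 2 = - of_nat l * a" by auto
qed

lemma reflect_poly_prod_list: "reflect_poly (\<Prod>x\<leftarrow>xs. f x) = (\<Prod>x\<leftarrow>xs. reflect_poly (f x :: 'a::idom poly))"
  by (induction xs) (simp_all add: reflect_poly_mult)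

text \<open>The first two power sums are read off from the coefficients after reversing the polynomials; the third and fourth
follow since every root satisfies \<open>x^3 = a x + b\<close>.\<close>

lemma cubic_power_sums:
  fixes as :: "complex list"
  assumes eq: "(\<Prod>a\<leftarrow>as. [:- a, 1:]) = [:- b, - a, 0, 1:] ^ l"
  shows "sum_list as = 0" "(\<Sum>x\<leftarrow>as. x ^ 2) = 2 * of_nat l * a"
    "(\<Sum>x\<leftarrow>as. x ^ 3) = of_nat (length as) * b" "(\<Sum>x\<leftarrow>as. x ^ 4) = 2 * of_nat l * a\<^sup>2"
proof -
  have "reflect_poly [:- b, - a, 0, 1:] = [:1, 0, - a, - b:]"
    by (simp add: reflect_poly_def cCons_def)
  moreover have "reflect_poly [:- x, 1:] = [:1, - x:]" for x :: complex
    by (simp add: reflect_poly_def cCons_def)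
  ultimately have "(\<Prod>x\<leftarrow>as. [:1, - x:]) = [:1, 0, - a, - b:] ^ l"
    using arg_cong[OF eq, of reflect_poly] by (simp add: reflect_poly_prod_list reflect_poly_power)
  note c = coeffs_prod_linear[of as, unfolded this coeffs_cubic_power]
  show s1: "sum_list as = 0" using c(2) by simp
  show s2: "(\<Sum>x\<leftarrow>as. x ^ 2) = 2 * of_nat l * a" using c(3) s1 by (auto simp: mult.assoc)
  have root: "x ^ 3 = a * x + b" if "x \<in> set as" for x
  proof -
    have "poly (\<Prod>a\<leftarrow>as. [:- a, 1:]) x = 0"
      using that by (induction as) auto
    then have "poly [:- b, - a, 0, 1:] x ^ l = 0" unfolding eq poly_power .
    then have "poly [:- b, - a, 0, 1:] x = 0" by simp
    then show ?thesis by (simp add: power3_eq_cube algebra_simps)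
  qed
  have "(\<Sum>x\<leftarrow>as. x ^ 3) = (\<Sum>x\<leftarrow>as. a * x + b)"
    using root by (intro arg_cong[where f = sum_list] map_cong) auto
  also have "\<dots> = a * sum_list as + of_nat (length as) * b"
    by (induction as) (simp_all add: algebra_simps)
  finally show "(\<Sum>x\<leftarrow>as. x ^ 3) = of_nat (length as) * b" using s1 by simp
  have "(\<Sum>x\<leftarrow>as. x ^ 4) = (\<Sum>x\<leftarrow>as. a * x ^ 2 + b * x)"
  proof (intro arg_cong[where f = sum_list] map_cong refl)
    fix x assume "x \<in> set as"
    have "x ^ 4 = x * x ^ 3" by (simp add: numeral_eq_Suc)
    then show "x ^ 4 = a * x ^ 2 + b * x" unfolding root[OF \<open>x \<in> set as\<close>]
      by (simp add: algebra_simps power2_eq_square)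
  qed
  also have "\<dots> = a * (\<Sum>x\<leftarrow>as. x ^ 2) + b * sum_list as"
    by (induction as) (simp_all add: algebra_simps)
  finally show "(\<Sum>x\<leftarrow>as. x ^ 4) = 2 * of_nat l * a\<^sup>2" using s1 s2 by (simp add: power2_eq_square)
qed

lemma real_cubic_traces:
  fixes A :: "real mat"
  assumes A: "A \<in> carrier_mat n n" and char: "char_poly A = [:- b, - a, 0, 1:] ^ l"
  shows "n = 3 * l" "mtrace n A = 0" "mtrace n (A * A) = 2 * real l * a"
    "mtrace n (A * (A * A)) = 3 * real l * b" "mtrace n ((A * A) * (A * A)) = 2 * real l * a\<^sup>2"
proof -
  show n: "n = 3 * l"
    using degree_monic_char_poly[OF A] unfolding char by (simp add: degree_power_eq)
  let ?A = "map_mat complex_of_real A"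
  have cA: "?A \<in> carrier_mat n n" using A by simp
  have char': "char_poly ?A = [:- of_real b, - of_real a, 0, 1:] ^ l"
  proof -
    interpret h: map_poly_comm_ring_hom complex_of_real ..
    show ?thesis unfolding of_real_hom.char_poly_hom[OF A] char by (simp add: h.hom_power)
  qed
  obtain as where as: "char_poly ?A = (\<Prod>a\<leftarrow>as. [:- a, 1:])" and len: "length as = n"
    using char_poly_factorized[OF cA] by auto
  note sums = cubic_power_sums[OF as[symmetric, unfolded char']]
  have tr: "of_real (mtrace n (A ^\<^sub>m k)) = (\<Sum>x\<leftarrow>as. x ^ k)" for k
  proof -
    have "of_real (mtrace n (A ^\<^sub>m k)) = mtrace n (map_mat complex_of_real (A ^\<^sub>m k))"
      using A unfolding mtrace_def by simp
    also have "map_mat complex_of_real (A ^\<^sub>m k) = ?A ^\<^sub>m k"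
      using of_real_hom.mat_hom_pow[OF A] .
    finally show ?thesis unfolding mtrace_pow[OF cA as] .
  qed
  have p1: "A ^\<^sub>m 1 = A" and p2: "A ^\<^sub>m 2 = A * A" and p3: "A ^\<^sub>m 3 = A * (A * A)"
    using A by (simp_all add: numeral_eq_Suc assoc_mult_mat[of A n n A n A n])
  have p4: "A ^\<^sub>m 4 = (A * A) * (A * A)"
  proof -
    have "A ^\<^sub>m 4 = A * A * A * A" using A by (simp add: numeral_eq_Suc del: assoc_mult_mat)
    also have "\<dots> = (A * A) * (A * A)" by (rule assoc_mult_mat[OF mult_carrier_mat[OF A A] A A])
    finally show ?thesis .
  qed
  show "mtrace n A = 0" using tr[of 1] sums(1) unfolding p1 by simp
  have "complex_of_real (mtrace n (A * A)) = complex_of_real (2 * real l * a)"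
    using tr[of 2] sums(2) unfolding p2 by simp
  then show "mtrace n (A * A) = 2 * real l * a" by (simp only: of_real_eq_iff)
  have "complex_of_real (mtrace n (A * (A * A))) = complex_of_real (3 * real l * b)"
    using tr[of 3] sums(3) unfolding p3 len n by simp
  then show "mtrace n (A * (A * A)) = 3 * real l * b" by (simp only: of_real_eq_iff)
  have "complex_of_real (mtrace n ((A * A) * (A * A))) = complex_of_real (2 * real l * a\<^sup>2)"
    using tr[of 4] sums(4) unfolding p4 by simp
  then show "mtrace n ((A * A) * (A * A)) = 2 * real l * a\<^sup>2" by (simp only: of_real_eq_iff)
qed

text \<open>A positive definite matrix is a product \<open>L\<^sup>T L\<close>: complete the square in the last variable and apply the
induction hypothesis to the Schur complement.\<close>

lemma posdef_factor:
  fixes g :: "nat \<Rightarrow> nat \<Rightarrow> real"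
  assumes "\<And>i j. i < n \<Longrightarrow> j < n \<Longrightarrow> g i j = g j i"
    and "\<And>x. \<exists>i<n. x i \<noteq> 0 \<Longrightarrow> (\<Sum>i<n. \<Sum>j<n. x i * g i j * x j) > 0"
  shows "\<exists>L. \<forall>i<n. \<forall>j<n. g i j = (\<Sum>k<n. L k i * L k j)"
  using assms
proof (induction n arbitrary: g)
  case (Suc n)
  define d where "d = g n n"
  have "(\<Sum>i<Suc n. \<Sum>j<Suc n. of_bool (i = n) * g i j * of_bool (j = n)) > 0"
    by (rule Suc.prems(2)) auto
  then have d: "d > 0" by (simp add: d_def)
  define g' where "g' i j = g i j - g i n * g n j / d" for i j
  have sym: "g i n = g n i" if "i < n" for i using Suc.prems(1)[of i n] that by simp
  obtain L where L: "\<And>i j. i < n \<Longrightarrow> j < n \<Longrightarrow> g' i j = (\<Sum>k<n. L k i * L k j)"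
  proof -
    have "\<exists>L. \<forall>i<n. \<forall>j<n. g' i j = (\<Sum>k<n. L k i * L k j)"
    proof (rule Suc.IH)
      show "g' i j = g' j i" if "i < n" "j < n" for i j
        using that Suc.prems(1)[of i j] sym by (simp add: g'_def)
    next
      fix x :: "nat \<Rightarrow> real" assume x: "\<exists>i<n. x i \<noteq> 0"
      define s where "s = (\<Sum>i<n. x i * g i n)"
      define c where "c = - s / d"
      define y where "y = x(n := c)"
      have s': "(\<Sum>j<n. g n j * x j) = s"
        unfolding s_def by (intro sum.cong refl) (simp add: sym mult.commute)
      have "0 < (\<Sum>i<Suc n. \<Sum>j<Suc n. y i * g i j * y j)"
        using x by (intro Suc.prems(2)) (auto simp: y_def)
      also have "\<dots> = (\<Sum>i<n. \<Sum>j<n. x i * g i j * x j) + (\<Sum>i<n. x i * g i n) * c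
          + (c * (\<Sum>j<n. g n j * x j) + c * d * c)"
        by (simp add: y_def d_def sum.distrib sum_distrib_right sum_distrib_left mult.assoc)
      also have "\<dots> = (\<Sum>i<n. \<Sum>j<n. x i * g i j * x j) - s * s / d"
        unfolding s' s_def[symmetric] c_def using d by (simp add: field_simps)
      also have "s * s / d = (\<Sum>i<n. \<Sum>j<n. x i * (g i n * g n j / d) * x j)"
        by (subst (2) s'[symmetric], subst s_def) (simp add: sum_product sum_divide_distrib mult_ac)
      also have "(\<Sum>i<n. \<Sum>j<n. x i * g i j * x j) - \<dots> = (\<Sum>i<n. \<Sum>j<n. x i * g' i j * x j)"
        by (simp add: g'_def algebra_simps sum_subtractf)
      finally show "(\<Sum>i<n. \<Sum>j<n. x i * g' i j * x j) > 0" .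
    qed
    then show ?thesis using that by blast
  qed
  define L' where "L' k i = (if k = n then g n i / sqrt d else if i = n then 0 else L k i)" for k i
  have "g i j = (\<Sum>k<Suc n. L' k i * L' k j)" if "i < Suc n" "j < Suc n" for i j
  proof -
    have "(\<Sum>k<Suc n. L' k i * L' k j) = (\<Sum>k<n. L' k i * L' k j) + g n i * g n j / d"
      using d by (simp add: L'_def)
    also have "(\<Sum>k<n. L' k i * L' k j) = (if i = n \<or> j = n then 0 else g' i j)"
      using that by (auto simp: L'_def L)
    finally show ?thesis
      using that d sym[of i] sym[of j] by (auto simp: g'_def d_def less_Suc_eq)
  qed
  then show ?case by blast
qed simp

text \<open>The space of the pairs \<open>(x, y)\<close>; the coordinate \<open>x\<^sub>0\<close> has been split off.\<close>

type_synonym coords = "(real ^ icosahedron_vertex) \<times> (real ^ icosahedron_edge)"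

text \<open>The form \<open>q\<close>.\<close>

definition cubic_part :: "coords \<Rightarrow> real" where
  "cubic_part v = (\<Sum>e\<in>UNIV. (\<Prod>i\<in>ends e. vec_nth (fst v) i) * vec_nth (snd v) e)"

lemma icosahedron_cubic_shift:
  "icosahedron_cubic (t *\<^sub>R e0 - (0, v)) = t ^ 3 - 3 * (v \<bullet> v) * t - 9 * cubic_part v"
proof -
  obtain x y where v: "v = (x, y)" by (cases v)
  have "(\<Prod>i\<in>ends e. vec_nth (- x) i) = (\<Prod>i\<in>ends e. vec_nth x i)" for e
    using card_icosahedron_edge_ends[OF ends[of e]] by (auto simp: card_2_iff)
  then show ?thesis
    unfolding v icosahedron_cubic_def e0_def cubic_part_def
    by (simp add: power2_norm_eq_inner sum_negf algebra_simps)
qed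

lemma pencil_carrier: "pencil D A v \<in> carrier_mat D D"
  by (simp add: pencil_def)

lemma pencil_entry: "r < D \<Longrightarrow> s < D \<Longrightarrow> pencil D A v $$ (r, s) = (\<Sum>b\<in>Basis. inner v b * A b $$ (r, s))"
  by (simp add: pencil_def)

lemma positive_definite_factor:
  assumes "positive_definite D G"
  obtains L where "L \<in> carrier_mat D D" "G = transpose_mat L * L"
proof -
  have G: "G \<in> carrier_mat D D" and sym: "transpose_mat G = G"
    and pd: "\<And>w. w \<in> carrier_vec D \<Longrightarrow> w \<noteq> 0\<^sub>v D \<Longrightarrow> 0 < scalar_prod w (G *\<^sub>v w)"
    using assms unfolding positive_definite_def symmetric_real_mat_def by auto
  have "\<exists>L. \<forall>i<D. \<forall>j<D. G $$ (i, j) = (\<Sum>k<D. L k i * L k j)"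
  proof (rule posdef_factor)
    show "G $$ (i, j) = G $$ (j, i)" if "i < D" "j < D" for i j
      using arg_cong[OF sym, of "\<lambda>M. M $$ (i, j)"] G that by auto
    fix x :: "nat \<Rightarrow> real" assume x: "\<exists>i<D. x i \<noteq> 0"
    define w where "w = Matrix.vec D x"
    have "w \<noteq> 0\<^sub>v D"
    proof
      assume "w = 0\<^sub>v D"
      obtain i where i: "i < D" "x i \<noteq> 0" using x by blast
      have "vec_index w i = 0" unfolding \<open>w = 0\<^sub>v D\<close> using i(1) by simp
      then show False using i by (simp add: w_def)
    qed
    then have "0 < scalar_prod w (G *\<^sub>v w)" by (intro pd) (simp_all add: w_def)
    also have "\<dots> = (\<Sum>i<D. \<Sum>j<D. x i * G $$ (i, j) * x j)"
      using G by (auto simp: w_def scalar_prod_def lessThan_atLeast0 sum_distrib_left mult.assoc)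
    finally show "0 < (\<Sum>i<D. \<Sum>j<D. x i * G $$ (i, j) * x j)" .
  qed
  then obtain f where f: "\<And>i j. i < D \<Longrightarrow> j < D \<Longrightarrow> G $$ (i, j) = (\<Sum>k<D. f k i * f k j)" by blast
  define L where "L = Matrix.mat D D (\<lambda>(k, i). f k i)"
  have L: "L \<in> carrier_mat D D" by (simp add: L_def)
  have "G = transpose_mat L * L"
  proof (rule eq_matI)
    fix i j assume "i < dim_row (transpose_mat L * L)" "j < dim_col (transpose_mat L * L)"
    then have ij: "i < D" "j < D" using L by auto
    show "G $$ (i, j) = (transpose_mat L * L) $$ (i, j)"
      unfolding f[OF ij] using ij L by (subst mat_mult_entry[of _ D D _ D]) (auto simp: L_def)
  qed (use G L in auto)
  with L show ?thesis using that by blast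
qed

lemma matrix_inverse:
  fixes L :: "real mat"
  assumes L: "L \<in> carrier_mat D D" and d: "Determinant.det L \<noteq> 0"
  obtains R where "R \<in> carrier_mat D D" "L * R = 1\<^sub>m D"
proof -
  have "L \<in> Units (ring_mat TYPE(real) D ())" by (rule det_non_zero_imp_unit[OF L d])
  then show ?thesis using that unfolding Units_def ring_mat_def by auto
qed

text \<open>With \<open>A\<^sub>0\<close> the matrix of \<^const>\<open>e0\<close> and \<open>R\<close> such that \<open>R\<^sup>T A\<^sub>0 R = 1\<close>, the family is \<open>N v = R\<^sup>T A(0, v) R\<close>, set to zero outside the
index range. The congruence does not change determinants, as \<open>A\<^sub>0\<close> has determinant \<open>1\<close>.\<close>

theorem determinantal_rep_traces:
  assumes rep: "definite_determinantal_rep (\<lambda>v. icosahedron_cubic v ^ l) e0"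
  obtains D and N :: "coords \<Rightarrow> nat \<Rightarrow> nat \<Rightarrow> real" where
    "\<And>v w r s. N (v + w) r s = N v r s + N w r s"
    "\<And>a v r s. N (a *\<^sub>R v) r s = a * N v r s"
    "\<And>v r s. N v r s = N v s r"
    "D = 3 * l"
    "\<And>v. (\<Sum>r<D. N v r r) = 0"
    "\<And>v. (\<Sum>r<D. \<Sum>s<D. N v r s * N v s r) = 6 * real l * (v \<bullet> v)"
    "\<And>v. (\<Sum>r<D. \<Sum>s<D. N v r s * (\<Sum>k<D. N v s k * N v k r)) = 27 * real l * cubic_part v"
    "\<And>v. (\<Sum>r<D. \<Sum>s<D. (\<Sum>k<D. N v r k * N v k s) * (\<Sum>k<D. N v s k * N v k r)) = 18 * real l * (v \<bullet> v)\<^sup>2"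
proof -
  obtain D A where sym: "\<And>b. b \<in> Basis \<Longrightarrow> symmetric_real_mat D (A b)"
    and det: "\<And>v. icosahedron_cubic v ^ l = Determinant.det (pencil D A v)"
    and pd: "positive_definite D (pencil D A e0)"
    using rep unfolding definite_determinantal_rep_def by auto
  obtain L where L: "L \<in> carrier_mat D D" and G: "pencil D A e0 = transpose_mat L * L"
    using positive_definite_factor[OF pd] .
  have "icosahedron_cubic e0 = 1" by (simp add: icosahedron_cubic_def e0_def)
  then have "Determinant.det L * Determinant.det L = 1"
    using det[of e0] L unfolding G by (simp add: det_mult[of _ D] det_transpose[of _ D])
  then have dL: "Determinant.det L \<noteq> 0" by auto
  obtain R where R: "R \<in> carrier_mat D D" and LR: "L * R = 1\<^sub>m D"
    using matrix_inverse[OF L dL] .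
  have dLR: "Determinant.det L * Determinant.det R = 1"
    using det_mult[OF L R] unfolding LR by simp
  have dR: "Determinant.det R * Determinant.det R = 1"
  proof -
    have "(Determinant.det L * Determinant.det L) * (Determinant.det R * Determinant.det R) = 1"
      using dLR by (metis mult.assoc mult.left_commute mult_1)
    then show ?thesis unfolding \<open>Determinant.det L * Determinant.det L = 1\<close> by simp
  qed
  have Rt: "transpose_mat R \<in> carrier_mat D D" using R by simp
  have RGR: "transpose_mat R * (pencil D A e0 * R) = 1\<^sub>m D"
  proof -
    have Lt: "transpose_mat L \<in> carrier_mat D D" using L by simp
    have "pencil D A e0 * R = transpose_mat L * (L * R)" unfolding G by (rule assoc_mult_mat[OF Lt L R])
    also have "\<dots> = transpose_mat L" unfolding LR using Lt by simp
    finally have "transpose_mat R * (pencil D A e0 * R) = transpose_mat (L * R)"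
      using transpose_mult[OF L R] by simp
    then show ?thesis unfolding LR by simp
  qed
  define M where "M v = transpose_mat R * (pencil D A v * R)" for v :: icosahedron_space
  have M: "M v \<in> carrier_mat D D" for v unfolding M_def using R pencil_carrier[of D A v] by auto
  have M_entry: "M v $$ (r, s) = (\<Sum>k<D. \<Sum>m<D. R $$ (k, r) * (pencil D A v $$ (k, m) * R $$ (m, s)))"
    if "r < D" "s < D" for v r s
    unfolding M_def using that R pencil_carrier[of D A v]
    by (simp add: mat_mult_entry[OF Rt mult_carrier_mat[OF pencil_carrier R]] mat_mult_entry[OF pencil_carrier R] sum_distrib_left
        del: index_mult_mat)
  have pencil_sym: "pencil D A v $$ (k, m) = pencil D A v $$ (m, k)" if "k < D" "m < D" for v k m
  proof -
    have "A b $$ (k, m) = A b $$ (m, k)" if "b \<in> Basis" for b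
      using sym[OF that] \<open>k < D\<close> \<open>m < D\<close> unfolding symmetric_real_mat_def
      by (metis carrier_matD index_transpose_mat(1))
    then show ?thesis using that by (simp add: pencil_entry)
  qed
  have M_sym: "M v $$ (r, s) = M v $$ (s, r)" if "r < D" "s < D" for v r s
    unfolding M_entry[OF that] M_entry[OF that(2,1)]
    by (subst sum.swap) (intro sum.cong refl, simp add: pencil_sym mult_ac)
  have M_add: "M (v + w) $$ (r, s) = M v $$ (r, s) + M w $$ (r, s)" if "r < D" "s < D" for v w r s
    unfolding M_entry[OF that] sum.distrib[symmetric]
    by (intro sum.cong refl) (simp add: pencil_entry inner_add_left sum.distrib algebra_simps)
  have M_scale: "M (a *\<^sub>R v) $$ (r, s) = a * M v $$ (r, s)" if "r < D" "s < D" for a v r s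
    unfolding M_entry[OF that] sum_distrib_left
    by (intro sum.cong refl) (simp add: pencil_entry sum_distrib_left sum_distrib_right mult_ac)
  \<comment> \<open>So \<open>t - M (0, v)\<close> is the value of \<open>M\<close> at \<open>t e0 - (0, v)\<close>, and its determinant is the characteristic polynomial.\<close>
  have M_e0: "M e0 = 1\<^sub>m D" unfolding M_def by (rule RGR)
  have M_det: "Determinant.det (M v) = icosahedron_cubic v ^ l" for v
  proof -
    have "Determinant.det (M v) = Determinant.det R * (Determinant.det (pencil D A v) * Determinant.det R)"
      unfolding M_def by (simp add: det_mult[OF Rt mult_carrier_mat[OF pencil_carrier R]] det_mult[OF pencil_carrier R] det_transpose[OF R])
    also have "\<dots> = Determinant.det (pencil D A v) * (Determinant.det R * Determinant.det R)" by simp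
    finally show ?thesis unfolding dR det by simp
  qed
  define B where "B v = M (0, v)" for v :: coords
  have B: "B v \<in> carrier_mat D D" for v unfolding B_def by (rule M)
  have char: "char_poly (B v) = [:- (9 * cubic_part v), - (3 * (v \<bullet> v)), 0, 1:] ^ l" for v
  proof (rule poly_ext)
    fix t :: real
    have "- char_matrix (B v) t = M (t *\<^sub>R e0 - (0, v))"
    proof (rule eq_matI)
      fix r s assume "r < dim_row (M (t *\<^sub>R e0 - (0, v)))" "s < dim_col (M (t *\<^sub>R e0 - (0, v)))"
      then have rs: "r < D" "s < D" using carrier_matD[OF M[of "t *\<^sub>R e0 - (0, v)"]] by simp_all
      have "M (t *\<^sub>R e0 - (0, v)) $$ (r, s) = t * M e0 $$ (r, s) + (- 1) * M (0, v) $$ (r, s)"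
      proof -
        have e: "t *\<^sub>R e0 - (0, v) = t *\<^sub>R e0 + (- 1) *\<^sub>R (0, v)"
          by (simp only: scaleR_minus1_left diff_conv_add_uminus)
        show ?thesis unfolding e by (simp only: M_add[OF rs] M_scale[OF rs])
      qed
      then show "(- char_matrix (B v) t) $$ (r, s) = M (t *\<^sub>R e0 - (0, v)) $$ (r, s)"
        using rs B[of v] unfolding M_e0 char_matrix_def by (auto simp: B_def)
    qed (use carrier_matD[OF M[of "t *\<^sub>R e0 - (0, v)"]] carrier_matD[OF B[of v]] in \<open>simp_all add: char_matrix_def\<close>)
    then have "poly (char_poly (B v)) t = icosahedron_cubic (t *\<^sub>R e0 - (0, v)) ^ l"
      unfolding char_poly_matrix[OF B] by (simp only: M_det)
    then show "poly (char_poly (B v)) t = poly ([:- (9 * cubic_part v), - (3 * (v \<bullet> v)), 0, 1:] ^ l) t"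
      unfolding icosahedron_cubic_shift by (simp add: power3_eq_cube algebra_simps)
  qed
  note traces = real_cubic_traces[OF B char]
  define N where "N v r s = (if r < D \<and> s < D then B v $$ (r, s) else 0)" for v r s
  have BB: "(B v * B v) $$ (r, s) = (\<Sum>k<D. N v r k * N v k s)" if "r < D" "s < D" for v r s
    unfolding mat_mult_entry[OF B B that] using that by (intro sum.cong refl) (simp add: N_def)
  have tr2: "mtrace D (X * Y) = (\<Sum>r<D. \<Sum>s<D. X $$ (r, s) * Y $$ (s, r))"
    if "X \<in> carrier_mat D D" "Y \<in> carrier_mat D D" for X Y :: "real mat"
    unfolding mtrace_def by (intro sum.cong refl) (simp add: mat_mult_entry[OF that])
  have BBc: "B v * B v \<in> carrier_mat D D" for v by (rule mult_carrier_mat[OF B B])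
  show ?thesis
  proof (rule that)
    show "N (v + w) r s = N v r s + N w r s" for v w r s
      using M_add[of r s "(0, v)" "(0, w)"] by (simp add: N_def B_def)
    show "N (a *\<^sub>R v) r s = a * N v r s" for a v r s
      using M_scale[of r s a "(0, v)"] by (simp add: N_def B_def)
    show "N v r s = N v s r" for v r s
      using M_sym[of r s] by (simp add: N_def B_def)
    show "D = 3 * l" by (rule traces(1))
    show "(\<Sum>r<D. N v r r) = 0" for v
      using traces(2)[of v] by (simp add: N_def mtrace_def)
    show "(\<Sum>r<D. \<Sum>s<D. N v r s * N v s r) = 6 * real l * (v \<bullet> v)" for v
      using traces(3)[of v] unfolding tr2[OF B B] by (simp add: N_def)
    show "(\<Sum>r<D. \<Sum>s<D. N v r s * (\<Sum>k<D. N v s k * N v k r)) = 27 * real l * cubic_part v" for v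
      using traces(4)[of v] unfolding tr2[OF B BBc] by (simp add: BB N_def)
    show "(\<Sum>r<D. \<Sum>s<D. (\<Sum>k<D. N v r k * N v k s) * (\<Sum>k<D. N v s k * N v k r)) = 18 * real l * (v \<bullet> v)\<^sup>2" for v
      using traces(5)[of v] unfolding tr2[OF BBc BBc] by (simp add: BB power2_eq_square)
  qed
qed

section \<open>Polarization\<close>

lemma polar4:
  fixes aa bb uu ww ab au aw bu bw uw :: real
  defines "q \<equiv> \<lambda>x y z. aa + bb + uu + ww + 2 * (x * ab + y * au + z * aw + x * y * bu + x * z * bw + y * z * uw)"
  shows "(q 1 1 1)\<^sup>2 - (q 1 1 (-1))\<^sup>2 - (q 1 (-1) 1)\<^sup>2 + (q 1 (-1) (-1))\<^sup>2
     - (q (-1) 1 1)\<^sup>2 + (q (-1) 1 (-1))\<^sup>2 + (q (-1) (-1) 1)\<^sup>2 - (q (-1) (-1) (-1))\<^sup>2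
     = 64 * (ab * uw + au * bw + aw * bu)"
  unfolding q_def by (simp add: power2_eq_square algebra_simps)

text \<open>Polarization of a quartic identity, by evaluating it at \<open>a \<plusminus> b \<plusminus> u \<plusminus> w\<close> with all eight choices of signs and adding up
with the product of the signs.\<close>

lemma polar_quartic:
  fixes C :: "'v::real_vector \<Rightarrow> 'v \<Rightarrow> 'p \<Rightarrow> real" and I :: "'v \<Rightarrow> 'v \<Rightarrow> real"
  assumes C: "\<And>p. bilinear (\<lambda>v w. C v w p)" "\<And>v w. C v w = C w v"
    and I: "bilinear I" "\<And>v w. I v w = I w v"
    and eq: "\<And>v. ip P (C v v) (C v v) = m * (I v v)\<^sup>2"
  shows "ip P (C a b) (C u w) + ip P (C a u) (C b w) + ip P (C a w) (C b u)
     = m * (I a b * I u w + I a u * I b w + I a w * I b u)"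
proof -
  define vec where "vec x y z = a + x *\<^sub>R b + y *\<^sub>R u + z *\<^sub>R w" for x y z :: real
  have expand: "f (vec x y z) (vec x y z) = f a a + f b b + f u u + f w w
      + 2 * (x * f a b + y * f a u + z * f a w + x * y * f b u + x * z * f b w + y * z * f u w)"
    if f: "bilinear f" "\<And>v w. f v w = f w v" and s: "x\<^sup>2 = 1" "y\<^sup>2 = 1" "z\<^sup>2 = 1" for f :: "'v \<Rightarrow> 'v \<Rightarrow> real" and x y z
  proof -
    have "f (vec x y z) (vec x y z) = f a a + x\<^sup>2 * f b b + y\<^sup>2 * f u u + z\<^sup>2 * f w w
      + (x * (f a b + f b a) + y * (f a u + f u a) + z * (f a w + f w a) + x * y * (f b u + f u b)
      + x * z * (f b w + f w b) + y * z * (f u w + f w u))"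
      unfolding vec_def
      by (simp add: bilinear_ladd[OF f(1)] bilinear_radd[OF f(1)] bilinear_lmul[OF f(1)] bilinear_rmul[OF f(1)]
          power2_eq_square algebra_simps)
    then show ?thesis unfolding s f(2)[of b a] f(2)[of u a] f(2)[of w a] f(2)[of u b] f(2)[of w b] f(2)[of w u]
      by simp
  qed
  define F where "F x y z = ip P (C (vec x y z) (vec x y z)) (C (vec x y z) (vec x y z))" for x y z
  have lhs: "F 1 1 1 - F 1 1 (-1) - F 1 (-1) 1 + F 1 (-1) (-1) - F (-1) 1 1 + F (-1) 1 (-1) + F (-1) (-1) 1 - F (-1) (-1) (-1)
     = 64 * (ip P (C a b) (C u w) + ip P (C a u) (C b w) + ip P (C a w) (C b u))"
  proof -
    have "F 1 1 1 - F 1 1 (-1) - F 1 (-1) 1 + F 1 (-1) (-1) - F (-1) 1 1 + F (-1) 1 (-1) + F (-1) (-1) 1 - F (-1) (-1) (-1)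
      = (\<Sum>p\<in>P. 64 * (C a b p * C u w p + C a u p * C b w p + C a w p * C b u p))"
      unfolding F_def ip_def sum_subtractf[symmetric] sum.distrib[symmetric]
    proof (rule sum.cong[OF refl])
      fix p
      have s: "C v w p = C w v p" for v w by (simp only: C(2)[of v w])
      show "C (vec 1 1 1) (vec 1 1 1) p * C (vec 1 1 1) (vec 1 1 1) p - C (vec 1 1 (-1)) (vec 1 1 (-1)) p * C (vec 1 1 (-1)) (vec 1 1 (-1)) p
        - C (vec 1 (-1) 1) (vec 1 (-1) 1) p * C (vec 1 (-1) 1) (vec 1 (-1) 1) p + C (vec 1 (-1) (-1)) (vec 1 (-1) (-1)) p * C (vec 1 (-1) (-1)) (vec 1 (-1) (-1)) p
        - C (vec (-1) 1 1) (vec (-1) 1 1) p * C (vec (-1) 1 1) (vec (-1) 1 1) p + C (vec (-1) 1 (-1)) (vec (-1) 1 (-1)) p * C (vec (-1) 1 (-1)) (vec (-1) 1 (-1)) p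
        + C (vec (-1) (-1) 1) (vec (-1) (-1) 1) p * C (vec (-1) (-1) 1) (vec (-1) (-1) 1) p - C (vec (-1) (-1) (-1)) (vec (-1) (-1) (-1)) p * C (vec (-1) (-1) (-1)) (vec (-1) (-1) (-1)) p
        = 64 * (C a b p * C u w p + C a u p * C b w p + C a w p * C b u p)"
        using polar4[of "C a a p" "C b b p" "C u u p" "C w w p" "C a b p" "C a u p" "C a w p" "C b u p" "C b w p" "C u w p"]
        by (simp only: expand[OF C(1) s] power2_eq_square mult_1 mult_minus_left minus_minus mult_1_right minus_mult_minus)
    qed
    then show ?thesis unfolding ip_def by (simp add: sum_distrib_left sum.distrib algebra_simps)
  qed
  have rhs: "F 1 1 1 - F 1 1 (-1) - F 1 (-1) 1 + F 1 (-1) (-1) - F (-1) 1 1 + F (-1) 1 (-1) + F (-1) (-1) 1 - F (-1) (-1) (-1)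
     = m * (64 * (I a b * I u w + I a u * I b w + I a w * I b u))"
    unfolding F_def eq
    using arg_cong[OF polar4[of "I a a" "I b b" "I u u" "I w w" "I a b" "I a u" "I a w" "I b u" "I b w" "I u w"], of "\<lambda>x. m * x"]
    by (simp only: expand[OF I] power2_eq_square mult_1 mult_minus_left minus_minus mult_1_right minus_mult_minus right_diff_distrib distrib_left)
  have "64 * (ip P (C a b) (C u w) + ip P (C a u) (C b w) + ip P (C a w) (C b u))
      = 64 * (m * (I a b * I u w + I a u * I b w + I a w * I b u))"
    using trans[OF lhs[symmetric] rhs] by (simp only: mult.left_commute)
  then show ?thesis by (simp only: mult_cancel_left) simp
qed

lemma polar_cubic:
  fixes C :: "'v::real_vector \<Rightarrow> 'v \<Rightarrow> real" and N :: "'v \<Rightarrow> real"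
  assumes C: "bilinear C" "\<And>v w. C v w = C w v" and N: "linear N"
  shows "N (a + b + u) * C (a + b + u) (a + b + u) - N (a + b - u) * C (a + b - u) (a + b - u)
      - N (a - b + u) * C (a - b + u) (a - b + u) + N (a - b - u) * C (a - b - u) (a - b - u)
      = 8 * (N a * C b u + N b * C a u + N u * C a b)"
  by (simp add: linear_add[OF N] linear_diff[OF N] bilinear_ladd[OF C(1)] bilinear_radd[OF C(1)] bilinear_lsub[OF C(1)]
      bilinear_rsub[OF C(1)] C(2)[of b a] C(2)[of u a] C(2)[of u b] algebra_simps)

text \<open>The coordinates \<open>x\<^sub>i\<close> and \<open>y\<^sub>i\<^sub>j\<close> in terms of the numbers of the vertices. If \<open>i\<close> and \<open>j\<close> are not adjacent, then
\<open>ecoord i j\<close> is an unspecified coordinate; it occurs only with the factor \<^term>\<open>adj01 i j = 0\<close>.\<close>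

definition vcoord :: "nat \<Rightarrow> coords \<Rightarrow> real" where
  "vcoord i v = vec_nth (fst v) (nth_vertex i)"

definition ecoord :: "nat \<Rightarrow> nat \<Rightarrow> coords \<Rightarrow> real" where
  "ecoord i j v = vec_nth (snd v) (Abs_icosahedron_edge {nth_vertex i, nth_vertex j})"

text \<open>The coordinate vector that belongs to a cell.\<close>

definition cell_vec :: "nat \<times> nat \<Rightarrow> coords" where
  "cell_vec = (\<lambda>(i, j). if i = j then (axis (nth_vertex i) 1, 0) else (0, axis (Abs_icosahedron_edge {nth_vertex i, nth_vertex j}) 1))"

lemma nth_vertex_eq_iff: "i < 12 \<Longrightarrow> j < 12 \<Longrightarrow> nth_vertex i = nth_vertex j \<longleftrightarrow> i = j"
  using nth_vertex_bij unfolding bij_betw_def inj_on_def by blast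

lemma Abs_edge_eq_iff:
  assumes "i < 12" "j < 12" "k < 12" "l < 12" "ico_adj i j" "ico_adj k l"
  shows "Abs_icosahedron_edge {nth_vertex i, nth_vertex j} = Abs_icosahedron_edge {nth_vertex k, nth_vertex l} \<longleftrightarrow> i = k \<and> j = l \<or> i = l \<and> j = k"
  using assms by (simp add: Abs_icosahedron_edge_inject nth_vertex_edge doubleton_eq_iff nth_vertex_eq_iff)

lemma cubic_part_asum: "cubic_part v = asum (\<lambda>i j. vcoord i v * vcoord j v * ecoord i j v) / 2"
proof -
  have "cubic_part v = (\<Sum>e\<in>UNIV. (\<lambda>S. (\<Prod>i\<in>S. vec_nth (fst v) i) * vec_nth (snd v) (Abs_icosahedron_edge S)) (ends e))"
    unfolding cubic_part_def by (simp add: ends_inverse)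
  also have "\<dots> = asum (\<lambda>i j. (\<Prod>i\<in>{nth_vertex i, nth_vertex j}. vec_nth (fst v) i) * vec_nth (snd v) (Abs_icosahedron_edge {nth_vertex i, nth_vertex j})) / 2"
    by (rule sum_edges)
  also have "\<dots> = asum (\<lambda>i j. vcoord i v * vcoord j v * ecoord i j v) / 2"
    unfolding asum_def
  proof (intro arg_cong2[where f = divide] sum.cong refl)
    fix i j :: nat assume "i \<in> {..<12}" "j \<in> {..<12}"
    then show "adj01 i j * ((\<Prod>i\<in>{nth_vertex i, nth_vertex j}. vec_nth (fst v) i) * vec_nth (snd v) (Abs_icosahedron_edge {nth_vertex i, nth_vertex j}))
        = adj01 i j * (vcoord i v * vcoord j v * ecoord i j v)"
      by (cases "i = j") (simp_all add: adj01_self nth_vertex_eq_iff vcoord_def ecoord_def)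
  qed
  finally show ?thesis .
qed

text \<open>The symmetric trilinear form with \<open>cubic_polar v v v = 12 * cubic_part v\<close>.\<close>

definition cubic_polar :: "coords \<Rightarrow> coords \<Rightarrow> coords \<Rightarrow> real" where
  "cubic_polar a b u = asum (\<lambda>i j.
      vcoord i a * vcoord j b * ecoord i j u + vcoord i a * vcoord j u * ecoord i j b
    + vcoord i b * vcoord j a * ecoord i j u + vcoord i b * vcoord j u * ecoord i j a
    + vcoord i u * vcoord j a * ecoord i j b + vcoord i u * vcoord j b * ecoord i j a)"

lemma cubic_part_polar:
  "cubic_part (a + b + u) - cubic_part (a + b - u) - cubic_part (a - b + u) + cubic_part (a - b - u)
    = 2 * cubic_polar a b u"
proof -
  have lin: "vcoord i (v + w) = vcoord i v + vcoord i w" "vcoord i (v - w) = vcoord i v - vcoord i w"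
    "ecoord i j (v + w) = ecoord i j v + ecoord i j w" "ecoord i j (v - w) = ecoord i j v - ecoord i j w" for i j v w
    by (simp_all add: vcoord_def ecoord_def)
  let ?f = "\<lambda>i j v. vcoord i v * vcoord j v * ecoord i j v"
  have "asum (\<lambda>i j. ?f i j (a + b + u)) - asum (\<lambda>i j. ?f i j (a + b - u)) - asum (\<lambda>i j. ?f i j (a - b + u))
     + asum (\<lambda>i j. ?f i j (a - b - u)) =
     asum (\<lambda>i j. ?f i j (a + b + u) - ?f i j (a + b - u) - ?f i j (a - b + u) + ?f i j (a - b - u))"
    unfolding asum_def by (simp add: sum.distrib sum_subtractf ring_distribs del: mult_cancel_left)
  also have "\<dots> = asum (\<lambda>i j. 4 * (vcoord i a * vcoord j b * ecoord i j u + vcoord i a * vcoord j u * ecoord i j b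
    + vcoord i b * vcoord j a * ecoord i j u + vcoord i b * vcoord j u * ecoord i j a
    + vcoord i u * vcoord j a * ecoord i j b + vcoord i u * vcoord j b * ecoord i j a))"
    by (intro arg_cong[where f = asum] ext) (simp add: lin algebra_simps)
  finally show ?thesis unfolding cubic_part_asum asum_cmult cubic_polar_def by (simp add: field_simps)
qed

lemma vcoord_vertex: "i < 12 \<Longrightarrow> k < 12 \<Longrightarrow> vcoord k (cell_vec (i, i)) = of_bool (k = i)"
  by (simp add: vcoord_def cell_vec_def axis_def nth_vertex_eq_iff)

lemma vcoord_edge: "i \<noteq> j \<Longrightarrow> vcoord k (cell_vec (i, j)) = 0"
  by (simp add: vcoord_def cell_vec_def)

lemma ecoord_vertex: "ecoord k l (cell_vec (i, i)) = 0"
  by (simp add: ecoord_def cell_vec_def)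

lemma ecoord_edge: "i \<noteq> j \<Longrightarrow> ecoord i j (cell_vec (i, j)) = 1" "i \<noteq> j \<Longrightarrow> ecoord j i (cell_vec (i, j)) = 1"
  by (simp_all add: ecoord_def cell_vec_def axis_def insert_commute)

lemma cubic_polar_edge:
  assumes "i < 12" "j < 12" "ico_adj i j"
  shows "cubic_polar (cell_vec (i, i)) (cell_vec (j, j)) (cell_vec (i, j)) = 2"
proof -
  have ij: "i \<noteq> j" using assms(3) ico_adj_irrefl by blast
  have d: "(\<Sum>k<12. \<Sum>l<12. of_bool (k = m) * (of_bool (l = n) * h k l)) = (h m n :: real)" if "m < 12" "n < 12" for m n :: nat and h
    unfolding sum_distrib_left[symmetric] by (simp only: delta_sum(1)[OF that(1)] delta_sum(1)[OF that(2)])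
  have "cubic_polar (cell_vec (i, i)) (cell_vec (j, j)) (cell_vec (i, j)) =
     (\<Sum>k<12. \<Sum>l<12. of_bool (k = i) * (of_bool (l = j) * (adj01 k l * ecoord k l (cell_vec (i, j))))
        + of_bool (k = j) * (of_bool (l = i) * (adj01 k l * ecoord k l (cell_vec (i, j)))))"
    unfolding cubic_polar_def asum_def
    by (intro sum.cong refl) (simp add: vcoord_vertex vcoord_edge ecoord_vertex assms(1,2) ij algebra_simps)
  also have "\<dots> = 2"
    unfolding sum.distrib d[OF assms(1,2)] d[OF assms(2,1)]
    using assms(3) ico_adj_sym[of i j] ij by (simp add: adj01_def ecoord_edge)
  finally show ?thesis .
qed

lemma cubic_polar_edges:
  assumes "i \<noteq> j" "k \<noteq> l" "m \<noteq> n"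
  shows "cubic_polar (cell_vec (i, j)) (cell_vec (k, l)) (cell_vec (m, n)) = 0"
  using assms unfolding cubic_polar_def by (simp add: vcoord_edge asum_def)

lemma cell_vec_sym: "cell_vec (i, j) = cell_vec (j, i)"
  by (simp add: cell_vec_def insert_commute)

lemma cell_vec_norm: "cell_vec a \<bullet> cell_vec a = 1"
  by (cases a) (simp add: cell_vec_def inner_axis_axis)

lemma cell_vec_orthogonal:
  assumes "i < 12" "j < 12" "k < 12" "l < 12" "i \<noteq> j \<Longrightarrow> ico_adj i j" "k \<noteq> l \<Longrightarrow> ico_adj k l"
    "(i, j) \<noteq> (k, l)" "(i, j) \<noteq> (l, k)"
  shows "cell_vec (i, j) \<bullet> cell_vec (k, l) = 0"
  using assms Abs_edge_eq_iff[of i j k l]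
  by (auto simp: cell_vec_def inner_axis_axis nth_vertex_eq_iff)

lemma cell_vec_cells:
  assumes "a \<in> set cells" "b \<in> set cells" "a \<noteq> b"
  shows "cell_vec a \<bullet> cell_vec b = 0"
proof -
  obtain i j k l where ab: "a = (i, j)" "b = (k, l)" by (cases a, cases b)
  have "i < 12" "j < 12" "k < 12" "l < 12" "i \<noteq> j \<Longrightarrow> ico_adj i j" "k \<noteq> l \<Longrightarrow> ico_adj k l" "i \<le> j" "k \<le> l"
    using assms(1,2) unfolding ab cells_def by auto
  then show ?thesis using assms(3) unfolding ab by (intro cell_vec_orthogonal) auto
qed

text \<open>The matrices \<open>C v w\<close> are the polarization of \<open>(N v)\<^sup>2 - 2 (v \<bullet> v)\<close>, and the trace is used as inner product. For symmetric
matrices the trace of \<open>N a N b N u\<close> does not depend on the order of the factors, so the three terms in the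
polarized cubic relation are equal.\<close>

theorem no_trace_family:
  fixes N :: "coords \<Rightarrow> nat \<Rightarrow> nat \<Rightarrow> real"
  assumes l: "l > 0"
    and add: "\<And>v w r s. N (v + w) r s = N v r s + N w r s"
    and scale: "\<And>a v r s. N (a *\<^sub>R v) r s = a * N v r s"
    and sym: "\<And>v r s. N v r s = N v s r"
    and D: "D = 3 * l"
    and t1: "\<And>v. (\<Sum>r<D. N v r r) = 0"
    and t2: "\<And>v. (\<Sum>r<D. \<Sum>s<D. N v r s * N v s r) = 6 * real l * (v \<bullet> v)"
    and t3: "\<And>v. (\<Sum>r<D. \<Sum>s<D. N v r s * (\<Sum>k<D. N v s k * N v k r)) = 27 * real l * cubic_part v"
    and t4: "\<And>v. (\<Sum>r<D. \<Sum>s<D. (\<Sum>k<D. N v r k * N v k s) * (\<Sum>k<D. N v s k * N v k r)) = 18 * real l * (v \<bullet> v)\<^sup>2"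
  shows False
proof -
  define K where "K = 6 * real l"
  have K: "K > 0" using l by (simp add: K_def)
  define P where "P = {..<D} \<times> {..<D}"
  define U where "U v = (\<lambda>(r, s). N v r s)" for v
  define C where "C v w = (\<lambda>(r, s). (\<Sum>k<D. N v r k * N w k s + N w r k * N v k s) / 2 - 2 * (v \<bullet> w) * of_bool (r = s))" for v w
  define S where "S v r s = (\<Sum>k<D. N v r k * N v k s)" for v r s
  have ipP: "ip P f h = (\<Sum>r<D. \<Sum>s<D. f (r, s) * h (r, s))" for f h
    unfolding ip_def P_def sum.cartesian_product by (simp add: case_prod_beta)
  have S_sym: "S v r s = S v s r" for v r s
    unfolding S_def by (intro sum.cong refl) (subst sym, subst (2) sym, rule mult.commute)
  have Cvv: "C v v (r, s) = S v r s - 2 * (v \<bullet> v) * of_bool (r = s)" for v r s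
    unfolding C_def S_def by (simp add: sum_distrib_left[symmetric])
  have C_sym: "C v w = C w v" for v w
    unfolding C_def by (intro ext) (simp add: case_prod_beta add.commute inner_commute)
  have C_lin: "linear (\<lambda>v. C v w p)" for w p
  proof (cases p)
    case (Pair r s)
    show ?thesis unfolding Pair C_def
    proof (rule linearI)
      fix v v'
      show "(case (r, s) of (r, s) \<Rightarrow> (\<Sum>k<D. N (v + v') r k * N w k s + N w r k * N (v + v') k s) / 2 - 2 * ((v + v') \<bullet> w) * of_bool (r = s)) =
        (case (r, s) of (r, s) \<Rightarrow> (\<Sum>k<D. N v r k * N w k s + N w r k * N v k s) / 2 - 2 * (v \<bullet> w) * of_bool (r = s)) +
        (case (r, s) of (r, s) \<Rightarrow> (\<Sum>k<D. N v' r k * N w k s + N w r k * N v' k s) / 2 - 2 * (v' \<bullet> w) * of_bool (r = s))"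
        by (simp add: add sum.distrib inner_add_left algebra_simps add_divide_distrib)
    next
      fix c v
      have "(\<Sum>k<D. N (c *\<^sub>R v) r k * N w k s + N w r k * N (c *\<^sub>R v) k s) = c * (\<Sum>k<D. N v r k * N w k s + N w r k * N v k s)"
        unfolding sum_distrib_left by (intro sum.cong refl) (simp add: scale algebra_simps)
      then show "(case (r, s) of (r, s) \<Rightarrow> (\<Sum>k<D. N (c *\<^sub>R v) r k * N w k s + N w r k * N (c *\<^sub>R v) k s) / 2 - 2 * (c *\<^sub>R v \<bullet> w) * of_bool (r = s)) =
        c *\<^sub>R (case (r, s) of (r, s) \<Rightarrow> (\<Sum>k<D. N v r k * N w k s + N w r k * N v k s) / 2 - 2 * (v \<bullet> w) * of_bool (r = s))"
        by (simp add: algebra_simps)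
    qed
  qed
  have C_bilin: "bilinear (\<lambda>v w. C v w p)" for p
    unfolding bilinear_def using C_lin[of _ p] by (subst C_sym) auto
  \<comment> \<open>The trace of \<open>((N v)\<^sup>2 - 2 n)\<^sup>2\<close>, where \<open>18 - 4 * 6 + 4 * 3 = 6\<close>.\<close>
  have CC: "ip P (C v v) (C v v) = K * (v \<bullet> v)\<^sup>2" for v
  proof -
    have "ip P (C v v) (C v v) = (\<Sum>r<D. \<Sum>s<D. S v r s * S v s r
        - 4 * (v \<bullet> v) * (of_bool (r = s) * S v r s) + 4 * (v \<bullet> v)\<^sup>2 * (of_bool (r = s) * 1))"
      unfolding ipP Cvv
      by (intro sum.cong refl) (subst (4) S_sym, auto simp: power2_eq_square algebra_simps of_bool_def)
    also have "\<dots> = (\<Sum>r<D. \<Sum>s<D. S v r s * S v s r)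
        - 4 * (v \<bullet> v) * (\<Sum>r<D. \<Sum>s<D. of_bool (r = s) * S v r s) + 4 * (v \<bullet> v)\<^sup>2 * (\<Sum>r<D. \<Sum>s<D. of_bool (r = s) * 1)"
      by (simp only: sum.distrib sum_subtractf sum_distrib_left)
    also have "(\<Sum>r<D. \<Sum>s<D. of_bool (r = s) * S v r s) = (\<Sum>r<D. S v r r)"
      by (intro sum.cong refl) (simp add: of_bool_def if_distrib[of "\<lambda>x. x * _"] cong: if_cong)
    also have "\<dots> = 6 * real l * (v \<bullet> v)" using t2[of v] by (simp add: S_def)
    also have "(\<Sum>r<D. \<Sum>s<D. of_bool (r = s) * 1) = real D"
      by (simp add: of_bool_def)
    also have "(\<Sum>r<D. \<Sum>s<D. S v r s * S v s r) = 18 * real l * (v \<bullet> v)\<^sup>2"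
      unfolding S_def by (rule t4)
    also have "real D = 3 * real l" by (simp add: D)
    finally show ?thesis unfolding K_def by (simp add: power2_eq_square algebra_simps)
  qed
  have I: "bilinear ((\<bullet>) :: coords \<Rightarrow> _)" "\<And>v w :: coords. v \<bullet> w = w \<bullet> v"
    unfolding bilinear_def by (auto intro!: linearI simp: inner_add_left inner_add_right inner_commute distrib_left)
  note quartic = polar_quartic[OF C_bilin C_sym I CC]
  define T where "T a b u = (\<Sum>r<D. \<Sum>s<D. \<Sum>k<D. N a r s * N b s k * N u k r)" for a b u
  have T_rot: "T a b u = T b u a" for a b u
  proof -
    have "T a b u = (\<Sum>s<D. \<Sum>r<D. \<Sum>k<D. N a r s * N b s k * N u k r)"
      unfolding T_def by (rule sum.swap)
    also have "\<dots> = (\<Sum>s<D. \<Sum>k<D. \<Sum>r<D. N a r s * N b s k * N u k r)"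
      by (intro sum.cong refl sum.swap)
    finally show ?thesis unfolding T_def by (simp add: mult_ac)
  qed
  have T_swap: "T a b u = T a u b" for a b u
  proof -
    have "T a b u = (\<Sum>s<D. \<Sum>r<D. \<Sum>k<D. N a r s * N b s k * N u k r)"
      unfolding T_def by (rule sum.swap)
    also have "\<dots> = (\<Sum>s<D. \<Sum>r<D. \<Sum>k<D. N a s r * N u r k * N b k s)"
      by (intro sum.cong refl) (simp add: sym[of a] sym[of b] sym[of u] mult_ac)
    finally show ?thesis unfolding T_def .
  qed
  have UC: "ip P (U a) (C b u) = T a b u" for a b u
  proof -
    have "ip P (U a) (C b u) = (\<Sum>r<D. \<Sum>s<D. (\<Sum>k<D. N a r s * N b r k * N u k s) / 2 + (\<Sum>k<D. N a r s * N u r k * N b k s) / 2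
        - 2 * (b \<bullet> u) * (of_bool (r = s) * N a r s))"
      unfolding ipP U_def C_def
      by (intro sum.cong refl) (simp add: sum.distrib sum_distrib_left algebra_simps add_divide_distrib)
    also have "\<dots> = (\<Sum>r<D. \<Sum>s<D. \<Sum>k<D. N a r s * N b r k * N u k s) / 2 + (\<Sum>r<D. \<Sum>s<D. \<Sum>k<D. N a r s * N u r k * N b k s) / 2
        - 2 * (b \<bullet> u) * (\<Sum>r<D. \<Sum>s<D. of_bool (r = s) * N a r s)"
      by (simp only: sum.distrib sum_subtractf sum_distrib_left sum_divide_distrib)
    also have "(\<Sum>r<D. \<Sum>s<D. of_bool (r = s) * N a r s) = (\<Sum>r<D. N a r r)"
      by (intro sum.cong refl) (simp add: of_bool_def if_distrib[of "\<lambda>x. x * _"] cong: if_cong)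
    also have "(\<Sum>r<D. \<Sum>s<D. \<Sum>k<D. N a r s * N b r k * N u k s) = T a u b"
      unfolding T_def by (intro sum.cong refl) (simp add: sym[of b] sym[of u] mult_ac)
    also have "(\<Sum>r<D. \<Sum>s<D. \<Sum>k<D. N a r s * N u r k * N b k s) = T a b u"
      unfolding T_def by (intro sum.cong refl) (simp add: sym[of b] sym[of u] mult_ac)
    finally show ?thesis using T_swap[of a b u] t1 by simp
  qed
  have U_lin: "linear (\<lambda>v. U v p)" for p
    by (rule linearI) (simp_all only: U_def case_prod_beta add scale real_scaleR_def)
  \<comment> \<open>The constant is \<open>2 * 27 * l / (3 * 8) = (3 / 8) * 6 * l\<close>: the three equal terms of the polarized left hand side have the factor \<open>8\<close>.\<close>
  have T_polar: "T a b u = K * (3 / 8) * cubic_polar a b u" for a b u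
  proof -
    have T_cubic: "ip P (U v) (C v v) = 27 * real l * cubic_part v" for v
    proof -
      have "T v v v = (\<Sum>r<D. \<Sum>s<D. N v r s * (\<Sum>k<D. N v s k * N v k r))"
        unfolding T_def by (simp add: sum_distrib_left mult.assoc)
      then show ?thesis unfolding UC t3 .
    qed
    have "27 * real l * (2 * cubic_polar a b u) =
        ip P (U (a + b + u)) (C (a + b + u) (a + b + u)) - ip P (U (a + b - u)) (C (a + b - u) (a + b - u))
      - ip P (U (a - b + u)) (C (a - b + u) (a - b + u)) + ip P (U (a - b - u)) (C (a - b - u) (a - b - u))"
      unfolding T_cubic cubic_part_polar[symmetric] by (simp add: algebra_simps)
    also have "\<dots> = (\<Sum>p\<in>P. 8 * (U a p * C b u p + U b p * C a u p + U u p * C a b p))"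
      unfolding ip_def sum_subtractf[symmetric] sum.distrib[symmetric]
    proof (rule sum.cong[OF refl])
      fix p
      have "C v w p = C w v p" for v w by (simp only: C_sym[of v w])
      from polar_cubic[OF C_bilin[of p] this U_lin[of p], of a b u]
      show "U (a + b + u) p * C (a + b + u) (a + b + u) p - U (a + b - u) p * C (a + b - u) (a + b - u) p
         - U (a - b + u) p * C (a - b + u) (a - b + u) p + U (a - b - u) p * C (a - b - u) (a - b - u) p
         = 8 * (U a p * C b u p + U b p * C a u p + U u p * C a b p)" .
    qed
    also have "\<dots> = 8 * (ip P (U a) (C b u) + ip P (U b) (C a u) + ip P (U u) (C a b))"
      unfolding ip_def by (simp only: sum.distrib sum_distrib_left[symmetric])
    also have "ip P (U b) (C a u) = T a b u" unfolding UC using T_rot T_swap by metis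
    also have "ip P (U u) (C a b) = T a b u" unfolding UC using T_rot by metis
    finally show ?thesis unfolding UC K_def by simp
  qed
  define u where "u a = (\<lambda>p. U (cell_vec a) p / sqrt K)" for a
  define c where "c a b = (\<lambda>p. C (cell_vec a) (cell_vec b) p / sqrt K)" for a b
  have scaled: "ip P (\<lambda>p. f p / sqrt K) (\<lambda>p. h p / sqrt K) = ip P f h / K" for f h
    unfolding ip_def using K by (simp add: sum_divide_distrib)
  have adj_ne: "i \<noteq> j" if "ico_adj i j" for i j using that ico_adj_irrefl by blast
  interpret icosahedral_gram P u c
  proof
    show "u (i, j) = u (j, i)" for i j unfolding u_def cell_vec_sym[of i j] ..
    show "c a b = c b a" for a b unfolding c_def C_sym[of "cell_vec a"] ..
    show "c (i, j) b = c (j, i) b" for i j b unfolding c_def cell_vec_sym[of i j] ..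
    show "ip P (u a) (u a) = 1" for a
    proof -
      have "ip P (U (cell_vec a)) (U (cell_vec a)) = K"
        using t2[of "cell_vec a"] unfolding ipP U_def K_def cell_vec_norm by (simp add: sym[of _ _ "_ :: nat"])
      then show ?thesis unfolding u_def scaled using K by simp
    qed
    show "ip P (c a a) (c a a) = 1" for a
      unfolding c_def scaled CC cell_vec_norm using K by simp
    show "ip P (c a a) (c b b) = 1 - 2 * ip P (c a b) (c a b)" if "a \<in> set cells" "b \<in> set cells" "a \<noteq> b" for a b
      using quartic[of "cell_vec a" "cell_vec a" "cell_vec b" "cell_vec b"] K
      unfolding c_def scaled cell_vec_cells[OF that] cell_vec_norm by (simp add: field_simps)
    fix i j k :: nat
    show "ip P (c (j, j) (i, j)) (c (k, k) (i, k)) + ip P (c (j, j) (i, k)) (c (k, k) (i, j))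
       + ip P (c (j, j) (k, k)) (c (i, j) (i, k)) = 0"
      if "i < 12" "j < 12" "k < 12" "ico_adj i j" "ico_adj j k" "ico_adj i k"
    proof -
      note o = cell_vec_orthogonal
      have "cell_vec (j, j) \<bullet> cell_vec (i, j) = 0" "cell_vec (k, k) \<bullet> cell_vec (i, k) = 0"
        "cell_vec (j, j) \<bullet> cell_vec (k, k) = 0" "cell_vec (j, j) \<bullet> cell_vec (i, k) = 0"
        "cell_vec (i, j) \<bullet> cell_vec (k, k) = 0" "cell_vec (i, j) \<bullet> cell_vec (i, k) = 0"
        using that adj_ne by (intro cell_vec_orthogonal; auto)+
      then show ?thesis
        using quartic[of "cell_vec (j, j)" "cell_vec (i, j)" "cell_vec (k, k)" "cell_vec (i, k)"] K
        unfolding c_def scaled C_sym[of "cell_vec (i, j)" "cell_vec (k, k)"]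
        by (simp add: add_divide_distrib[symmetric] add_ac)
    qed
    show "ip P (u (i, i)) (c (j, j) (i, j)) = 3 / 4" if "i < 12" "j < 12" "ico_adj i j"
      unfolding u_def c_def scaled UC T_polar cubic_polar_edge[OF that] using K by simp
    show "ip P (u (i, j)) (c (i, i) (j, j)) = 3 / 4" if "i < 12" "j < 12" "ico_adj i j"
      unfolding u_def c_def scaled UC
      unfolding T_rot[of "cell_vec (i, j)"] unfolding T_polar cubic_polar_edge[OF that] using K by simp
    show "ip P (u (j, k)) (c (i, j) (i, k)) = 0" if "i < 12" "j < 12" "k < 12" "ico_adj i j" "ico_adj j k" "ico_adj i k"
      unfolding u_def c_def scaled UC T_polar using that adj_ne by (simp add: cubic_polar_edges)
  qed
  show False by (rule gram_contradiction)
qed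


theorem corollary5p7:
  shows "hyperbolic icosahedron_cubic e0 \<and>
    \<not> (\<exists>l::nat. l > 0 \<and> definite_determinantal_rep (\<lambda>v. icosahedron_cubic v ^ l) e0)"
proof (intro conjI notI)
  show "hyperbolic icosahedron_cubic e0" by (rule hyperbolic_icosahedron_cubic)
  assume "\<exists>l::nat. l > 0 \<and> definite_determinantal_rep (\<lambda>v. icosahedron_cubic v ^ l) e0"
  then obtain l :: nat where l: "l > 0" and rep: "definite_determinantal_rep (\<lambda>v. icosahedron_cubic v ^ l) e0"
    by blast
  show False by (rule determinantal_rep_traces[OF rep]) (rule no_trace_family[OF l])
qed

end
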